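(* Let $G=(V,E)$ be any (possibly non-bipartite) unweighted, undirected graph with $n=|V|$ and $m=|E|$, and let $0<\epsilon<1$ be any approximation parameter. There exists a deterministic single-pass streaming algorithm which, when the edges of $G$ arrive as a stream $e_1,\ldots,e_m$ whose order is a uniformly random permutation of $E$, with high probability outputs a matching of $G$ of size at least $(2/3-\epsilon)\mu(G)$. The algorithm uses $O(n\log(n)\,\mathrm{poly}(\epsilon^{-1}))$ space.
   Context: $\mu(G)$ denotes the size of a maximum matching in $G$. A single-pass streaming algorithm reads the edges of the stream once, in order, and space is measured in words of $O(\log n)$ bits (so that one edge occupies $O(1)$ space). The only randomness is that of the order of the stream; "with high probability" refers to this randomness. *)

theory Defs
  imports "HOL-Probability.Probability" "HOL-Combinatorics.Multiset_Permutations"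
    "HOL-Library.Disjoint_Sets"
begin

definition simple_graph :: "'a set \<Rightarrow> 'a set set \<Rightarrow> bool" where
  "simple_graph V E \<longleftrightarrow> finite V \<and> (\<forall>e\<in>E. e \<subseteq> V \<and> card e = 2)"

definition matching :: "'a set set \<Rightarrow> 'a set set \<Rightarrow> bool" where
  "matching E M \<longleftrightarrow> M \<subseteq> E \<and> disjoint M"

definition matching_number :: "'a set set \<Rightarrow> nat" where
  "matching_number E = Max (card ` {M. matching E M})"

text \<open>
  A deterministic single-pass streaming algorithm over items of type \<open>'e\<close>. Its memory is a
  list of words. All that it remembers of the part of the stream read so far is that list.
\<close>

record ('e, 'o) streaming_alg =
  init_mem :: "nat list"
  update_mem :: "nat list \<Rightarrow> 'e \<Rightarrow> nat list"
  result :: "nat list \<Rightarrow> 'o"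

definition memory_after :: "('e, 'o) streaming_alg \<Rightarrow> 'e list \<Rightarrow> nat list" where
  "memory_after A es = foldl (update_mem A) (init_mem A) es"

definition output_on :: "('e, 'o) streaming_alg \<Rightarrow> 'e list \<Rightarrow> 'o" where
  "output_on A es = result A (memory_after A es)"

text \<open>
  On every stream of a graph with vertex set \<open>V\<close>, in every order, the memory holds at most
  \<open>s\<close> words of \<open>w\<close> bits. A prefix of such a stream is again the stream of a graph on \<open>V\<close>, so
  the bound holds at every point during the pass.
\<close>

definition uses_space :: "'a set \<Rightarrow> ('a set, 'o) streaming_alg \<Rightarrow> nat \<Rightarrow> real \<Rightarrow> bool" where
  "uses_space V A w s \<longleftrightarrow>
     (\<forall>es. distinct es \<and> simple_graph V (set es) \<longrightarrow>
        real (length (memory_after A es)) \<le> s \<and> (\<forall>x\<in>set (memory_after A es). x < 2 ^ w))"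

definition random_order :: "'e set \<Rightarrow> 'e list pmf" where
  "random_order E = pmf_of_set (permutations_of_set E)"

end

theory Submission
  imports Defs
begin

text \<open>
  The algorithm is Bernstein's: with \<open>\<beta> = D\<^sup>2\<close>, it maintains a subgraph \<open>H\<close> all of whose edges have
  degree sum at most \<open>\<beta>\<close>, inserting edges of degree sum below \<open>\<beta> - D\<close> and deleting overfull ones.
  A potential bounds the number of changes by \<open>N = n \<beta>\<^sup>2\<close>, so soon there are \<open>\<alpha>\<close> consecutive edges
  without a change. In a random order this means that few of the remaining edges are underfull for
  \<open>H\<close>, and all of these are stored in \<open>U\<close>. Every later edge lies in \<open>H \<union> U\<close> or has a large degree
  sum in \<open>H\<close>, and then \<open>H \<union> U\<close> contains almost \<open>2/3\<close> of a maximum matching of the later edges.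
  For this last step we count \<open>H\<close>-edges against a Tutte--Berge witness of \<open>H \<union> U\<close>, which treats
  non-bipartite graphs directly. Few edges of a fixed maximum matching are among the early edges, as a
  graph with small matching number has so few edges that it is stored completely. The length of the
  stream is not known in advance and is guessed up to a constant factor.
\<close>

section \<open>Matchings and the Tutte--Berge formula\<close>

text \<open>Two tensions fix the parameters. The tolerance \<open>D\<close> between the degree
  thresholds is also the size that separates small from large parts: a vertex in a small part loses
  at most \<open>D\<close> of its \<open>H\<close>-edges there, and a large part loses at most a
  share \<open>1 / D\<close> by rounding. Against degree sums near \<open>D\<^sup>2\<close> both are
  relative errors of order \<open>1 / D\<close>, so \<open>D\<close> is of order
  \<open>1 / \<epsilon>\<close>. For the memory, \<open>\<alpha>\<close> edges without a change
  leave about \<open>m log n / \<alpha>\<close> underfull ones, which asks for a large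
  \<open>\<alpha>\<close>, while the \<open>budget * \<alpha>\<close> edges spent before freezing
  must be a small share of the stream, which asks for a small one. With \<open>\<alpha>\<close> of
  order \<open>\<epsilon> m / budget\<close> the length \<open>m\<close> cancels, and about
  \<open>budget * log n\<close> edges are stored, up to powers of \<open>1 / \<epsilon>\<close>.
  Freezing is decided by looking at the stream, so the random-order argument is made for each fixed
  position and prefix, followed by a union bound over positions.\<close>

lemma finite_has_argmax:
  fixes f :: "'b \<Rightarrow> 'c :: linorder"
  assumes "finite S" "S \<noteq> {}"
  obtains x where "x \<in> S" "\<And>y. y \<in> S \<Longrightarrow> f y \<le> f x"
proof -
  have "Max (f ` S) \<in> f ` S" using assms by (intro Max_in) auto
  then obtain x where "x \<in> S" "f x = Max (f ` S)" by auto
  with assms(1) show ?thesis by (intro that[of x]) auto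
qed

lemma simple_graph_finite: "simple_graph V E \<Longrightarrow> finite E"
  unfolding simple_graph_def by (meson PowI finite_Pow_iff finite_subset subsetI)

lemma simple_graph_subset: "simple_graph V E \<Longrightarrow> F \<subseteq> E \<Longrightarrow> simple_graph V F"
  unfolding simple_graph_def by blast

lemma simple_graph_edgeE:
  assumes "simple_graph V E" "e \<in> E" "x \<in> e"
  obtains y where "e = {x, y}" "x \<noteq> y" "x \<in> V" "y \<in> V"
proof -
  have "card e = 2" "e \<subseteq> V" using assms by (auto simp: simple_graph_def)
  then obtain a b where "e = {a, b}" "a \<noteq> b" by (meson card_2_iff)
  with assms \<open>e \<subseteq> V\<close> show ?thesis
    by (metis doubleton_eq_iff insert_iff insert_subset singletonD that)
qed

lemma finite_matchings: "finite E \<Longrightarrow> finite {M. matching E M}"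
  by (rule finite_subset[of _ "Pow E"]) (auto simp: matching_def)

lemma matching_empty: "matching E {}"
  by (simp add: matching_def)

lemma matching_subset: "matching E M \<Longrightarrow> N \<subseteq> M \<Longrightarrow> matching E N"
  by (meson matching_def order_trans pairwise_subset)

lemma matching_mono: "matching E M \<Longrightarrow> M \<subseteq> F \<Longrightarrow> matching F M"
  by (simp add: matching_def)

lemma matching_eqI: "matching E M \<Longrightarrow> e \<in> M \<Longrightarrow> f \<in> M \<Longrightarrow> x \<in> e \<Longrightarrow> x \<in> f \<Longrightarrow> e = f"
  by (metis IntI disjoint_iff matching_def pairwiseD disjnt_def)

lemma matching_insert:
  assumes "matching E M" "e \<in> E" "e \<inter> \<Union>M = {}"
  shows "matching E (insert e M)"
  using assms unfolding matching_def
  by (auto simp: pairwise_insert disjnt_def)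

lemma card_le_matching_number: "finite E \<Longrightarrow> matching E M \<Longrightarrow> card M \<le> matching_number E"
  unfolding matching_number_def by (intro Max_ge) (auto simp: finite_matchings)

lemma maximum_matching_exists:
  assumes "finite E" obtains M where "matching E M" "card M = matching_number E"
proof -
  have "matching_number E \<in> card ` {M. matching E M}"
    unfolding matching_number_def using matching_empty
    by (intro Max_in) (auto simp: finite_matchings assms)
  then show ?thesis using that by auto
qed

lemma card_Union_matching:
  assumes "simple_graph V E" "matching E M"
  shows "card (\<Union>M) = 2 * card M"
proof -
  have "finite M" "\<And>e. e \<in> M \<Longrightarrow> card e = 2"
    using finite_subset[OF _ simple_graph_finite[OF assms(1)]] assms
    by (auto simp: matching_def simple_graph_def)
  moreover have "card (\<Union>M) = sum card M"
    using assms by (intro card_Union_disjoint)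
      (auto simp: matching_def simple_graph_def card_ge_0_finite)
  ultimately show ?thesis by simp
qed

lemma Union_matching_subset: "simple_graph V E \<Longrightarrow> matching E M \<Longrightarrow> \<Union>M \<subseteq> V"
  unfolding simple_graph_def matching_def by blast

section \<open>Exchanges between maximum matchings\<close>

definition max_matching :: "'a set set \<Rightarrow> 'a set set \<Rightarrow> bool" where
  "max_matching E M \<longleftrightarrow> matching E M \<and> card M = matching_number E"

text \<open>
  The exchange argument of Gallai's lemma: a maximum matching missing \<open>t\<close> with the largest overlap
  with \<open>M\<close> could be switched along one edge of \<open>M\<close>.
\<close>

lemma missed_pair_trans:
  assumes G: "simple_graph V E"
    and miss: "\<exists>N. max_matching E N \<and> t \<notin> \<Union>N"
    and ut: "\<And>M. max_matching E M \<Longrightarrow> u \<in> \<Union>M \<or> t \<in> \<Union>M"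
    and tv: "\<And>M. max_matching E M \<Longrightarrow> t \<in> \<Union>M \<or> v \<in> \<Union>M"
    and M: "max_matching E M" and "u \<noteq> v"
  shows "u \<in> \<Union>M \<or> v \<in> \<Union>M"
proof (rule ccontr)
  assume "\<not> ?thesis"
  then have u: "u \<notin> \<Union>M" and v: "v \<notin> \<Union>M" by auto
  have finE: "finite E" using G by (rule simple_graph_finite)
  define \<N> where "\<N> = {N. max_matching E N \<and> t \<notin> \<Union>N}"
  have "finite \<N>" using finite_matchings[OF finE]
    by (rule rev_finite_subset) (auto simp: \<N>_def max_matching_def)
  moreover have "\<N> \<noteq> {}" using miss by (auto simp: \<N>_def)
  ultimately obtain N where N: "N \<in> \<N>" and best: "\<And>N'. N' \<in> \<N> \<Longrightarrow> card (M \<inter> N') \<le> card (M \<inter> N)"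
    using finite_has_argmax[of \<N> "\<lambda>N. card (M \<inter> N)"] by blast
  have mM: "matching E M" and mN: "matching E N" and cM: "card M = matching_number E"
    and cN: "card N = matching_number E" and tN: "t \<notin> \<Union>N"
    using M N by (auto simp: \<N>_def max_matching_def)
  have fM: "finite M" "finite N" using mM mN finE by (auto simp: matching_def intro: finite_subset)
  have fin: "finite (\<Union>M)" "finite (\<Union>N)"
    using Union_matching_subset[OF G mM] Union_matching_subset[OF G mN] G
    unfolding simple_graph_def by (blast intro: finite_subset)+
  have "u \<in> \<Union>N" "v \<in> \<Union>N" "t \<in> \<Union>M"
    using ut[of N] tv[of N] ut[OF M] u N unfolding \<N>_def by blast+
  \<comment> \<open>Both matchings cover equally many vertices, and \<open>N\<close> covers
    \<open>u\<close> and \<open>v\<close>, which \<open>M\<close> misses. So \<open>M\<close> covers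
    at least two vertices that \<open>N\<close> misses, and one of them is not
    \<open>t\<close>.\<close>
  have "card (\<Union>M) = card (\<Union>N)"
    using card_Union_matching[OF G mM] card_Union_matching[OF G mN] cM cN by simp
  then have "card (\<Union>M - \<Union>N) = card (\<Union>N - \<Union>M)"
    using card_Diff_subset_Int[of "\<Union>M" "\<Union>N"] card_Diff_subset_Int[of "\<Union>N" "\<Union>M"] fin
    by (metis Int_commute finite_Int)
  also have "card {u, v} \<le> card (\<Union>N - \<Union>M)"
    using \<open>u \<in> \<Union>N\<close> \<open>v \<in> \<Union>N\<close> u v fin by (intro card_mono) auto
  finally have "card (\<Union>M - \<Union>N) \<ge> 2" using \<open>u \<noteq> v\<close> by simp
  then have "\<not> \<Union>M - \<Union>N \<subseteq> {t}"
    using card_mono[of "{t}" "\<Union>M - \<Union>N"] by fastforce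
  then obtain x e where x: "x \<in> e" "e \<in> M" "x \<notin> \<Union>N" "x \<noteq> t" by blast
  have "e \<in> E" using x mM by (auto simp: matching_def)
  then obtain y where y: "e = {x, y}" "x \<noteq> y"
    using simple_graph_edgeE[OF G] x(1) by metis
  have "e \<notin> N" using x by blast
  have "y \<in> \<Union>N"
  proof (rule ccontr)
    assume "y \<notin> \<Union>N"
    then have "matching E (insert e N)"
      using x y by (intro matching_insert mN \<open>e \<in> E\<close>) auto
    then have "card (insert e N) \<le> matching_number E" by (rule card_le_matching_number[OF finE])
    then show False using cN fM \<open>e \<notin> N\<close> by simp
  qed
  then obtain f where f: "f \<in> N" "y \<in> f" by blast
  \<comment> \<open>Exchanging \<open>f\<close> for \<open>e\<close> keeps the size and still misses
    \<open>t\<close>. It gains \<open>e\<close> in the overlap with \<open>M\<close> and loses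
    nothing there, since \<open>f\<close> meets \<open>e\<close> in \<open>y\<close> and hence is
    not in \<open>M\<close>.\<close>
  have "y \<notin> \<Union>(N - {f})" using matching_eqI[OF mN f(1) _ f(2)] by blast
  then have "matching E (insert e (N - {f}))"
    using x y by (intro matching_insert matching_subset[OF mN] \<open>e \<in> E\<close>) auto
  moreover have "card (insert e (N - {f})) = matching_number E"
    using cN fM \<open>e \<notin> N\<close> f by (metis DiffE card_Suc_Diff1 card_insert_disjoint finite_Diff)
  moreover have "t \<notin> \<Union>(insert e (N - {f}))"
    using x y \<open>y \<in> \<Union>N\<close> tN by auto
  ultimately have "insert e (N - {f}) \<in> \<N>" by (auto simp: \<N>_def max_matching_def)
  then have "card (M \<inter> insert e (N - {f})) \<le> card (M \<inter> N)" by (rule best)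
  moreover have "f \<notin> M"
    using matching_eqI[OF mM _ x(2) f(2)] y f x by blast
  then have "M \<inter> insert e (N - {f}) = insert e (M \<inter> N)" using x by blast
  ultimately show False using fM \<open>e \<notin> N\<close> by simp
qed

text \<open>
  The nontrivial half of the Tutte--Berge formula. If every vertex is missed by some maximum
  matching, the parts are the classes of the relation that no maximum matching misses both vertices.
\<close>

lemma tutte_berge:
  assumes "simple_graph V E"
  shows "\<exists>A P. A \<subseteq> V \<and> partition_on (V - A) P \<and> (\<forall>e\<in>E. e \<inter> A = {} \<longrightarrow> (\<exists>C\<in>P. e \<subseteq> C)) \<and>
           card A + (\<Sum>C\<in>P. card C div 2) \<le> matching_number E"
  using assms
proof (induction "card V" arbitrary: V E rule: less_induct)
  case less
  note G = less.prems
  have finE: "finite E" and finV: "finite V"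
    using G simple_graph_finite by (auto simp: simple_graph_def)
  show ?case
  proof (cases "\<exists>v\<in>V. \<forall>M. max_matching E M \<longrightarrow> v \<in> \<Union>M")
    \<comment> \<open>A vertex covered by every maximum matching goes into \<open>A\<close>:
      deleting it lowers the matching number, and this pays for it in the induction.\<close>
    case True
    then obtain v where v: "v \<in> V" "\<And>M. max_matching E M \<Longrightarrow> v \<in> \<Union>M" by blast
    define E' where "E' = {e \<in> E. v \<notin> e}"
    have G': "simple_graph (V - {v}) E'"
      using G by (auto simp: simple_graph_def E'_def)
    obtain M where M: "matching E' M" "card M = matching_number E'"
      using maximum_matching_exists simple_graph_finite[OF G'] by blast
    have "matching E M" "v \<notin> \<Union>M"
      using M(1) by (auto simp: matching_def E'_def)
    then have "card M \<noteq> matching_number E" using v(2) by (auto simp: max_matching_def)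
    with card_le_matching_number[OF finE \<open>matching E M\<close>] M have lt: "matching_number E' < matching_number E"
      by simp
    obtain A P where AP: "A \<subseteq> V - {v}" "partition_on (V - {v} - A) P"
      "\<forall>e\<in>E'. e \<inter> A = {} \<longrightarrow> (\<exists>C\<in>P. e \<subseteq> C)"
      "card A + (\<Sum>C\<in>P. card C div 2) \<le> matching_number E'"
      using less.hyps[OF _ G'] v finV by (metis card_Diff1_less)
    show ?thesis
    proof (intro exI conjI)
      show "insert v A \<subseteq> V" using AP v by blast
      show "partition_on (V - insert v A) P" using AP(2) by (simp add: Diff_insert2[of V v A])
      show "\<forall>e\<in>E. e \<inter> insert v A = {} \<longrightarrow> (\<exists>C\<in>P. e \<subseteq> C)"
        using AP(3) by (auto simp: E'_def)
      have "card (insert v A) \<le> Suc (card A)" by (rule card_insert_le_m1) simp_all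
      then show "card (insert v A) + (\<Sum>C\<in>P. card C div 2) \<le> matching_number E"
        using AP(4) lt by linarith
    qed
  next
    case False
    define r where "r = {(u, v). u \<in> V \<and> v \<in> V \<and>
      (u = v \<or> (\<forall>M. max_matching E M \<longrightarrow> u \<in> \<Union>M \<or> v \<in> \<Union>M))}"
    have missed: "\<exists>N. max_matching E N \<and> t \<notin> \<Union>N" if "t \<in> V" for t using False that by blast
    have "trans r"
    proof (rule transI)
      fix u t v assume ut: "(u, t) \<in> r" and tv: "(t, v) \<in> r"
      then have V: "u \<in> V" "t \<in> V" "v \<in> V" by (auto simp: r_def)
      show "(u, v) \<in> r"
      proof (cases "u = t \<or> t = v \<or> u = v")
        case True
        then show ?thesis using ut tv V by (auto simp: r_def)
      next
        case False
        then have "u \<in> \<Union>M \<or> v \<in> \<Union>M" if "max_matching E M" for M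
          using missed_pair_trans[OF G missed[OF V(2)] _ _ that, of u v] ut tv by (simp add: r_def)
        then show ?thesis using V by (simp add: r_def)
      qed
    qed
    then have equiv: "equiv V r"
      by (intro equivI) (auto simp: r_def refl_on_def sym_def)
    define P where "P = V // r"
    have part: "partition_on V P" unfolding P_def by (rule partition_on_quotient[OF equiv])
    have edge: "\<exists>C\<in>P. e \<subseteq> C" if "e \<in> E" for e
    proof -
      obtain u v where e: "e = {u, v}" "u \<noteq> v" "u \<in> V" "v \<in> V"
        using \<open>e \<in> E\<close> G by (metis card_2_iff insert_subset simple_graph_def)
      have "u \<in> \<Union>M \<or> v \<in> \<Union>M" if "max_matching E M" for M
      proof (rule ccontr)
        assume *: "\<not> ?thesis"
        then have "matching E (insert e M)"
          using e \<open>e \<in> E\<close> that by (intro matching_insert) (auto simp: max_matching_def)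
        moreover have "e \<notin> M" using * e by blast
        moreover have "finite M" using that finE by (auto simp: max_matching_def matching_def intro: finite_subset)
        ultimately show False
          using card_le_matching_number[OF finE, of "insert e M"] that by (simp add: max_matching_def)
      qed
      then have "(u, v) \<in> r" using e by (auto simp: r_def)
      then have "e \<subseteq> r `` {u}" using e by (auto simp: r_def)
      then show ?thesis using e by (auto simp: P_def quotient_def)
    qed
    obtain M where M: "matching E M" "card M = matching_number E"
      using maximum_matching_exists finE by blast
    have finM: "finite M" using M finE by (auto simp: matching_def intro: finite_subset)
    have finP: "finite P" using finV equiv by (auto simp: P_def finite_quotient equiv_def refl_on_def r_def intro!: finite_quotient)
    \<comment> \<open>A class contains at most one vertex missed by \<open>M\<close>, and an edge of
      \<open>M\<close> that meets the class lies inside it. So \<open>M\<close> matches all but at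
      most one of its vertices within the class.\<close>
    have half: "card C div 2 \<le> card {e \<in> M. e \<subseteq> C}" if C: "C \<in> P" for C
    proof -
      have CV: "C \<subseteq> V" using C part by (auto simp: partition_on_def)
      have one: "x = y" if "x \<in> C - \<Union>M" "y \<in> C - \<Union>M" for x y
      proof -
        have "(x, y) \<in> r" using that C quotient_eq_iff[OF equiv] by (auto simp: P_def)
        then show ?thesis using that M by (auto simp: r_def max_matching_def)
      qed
      have "C \<inter> \<Union>M \<subseteq> \<Union>{e \<in> M. e \<subseteq> C}"
      proof
        fix x assume "x \<in> C \<inter> \<Union>M"
        then obtain e where e: "x \<in> e" "e \<in> M" "x \<in> C" by blast
        obtain C' where "C' \<in> P" "e \<subseteq> C'" using edge[of e] e M(1) unfolding matching_def by blast
        then have "C' = C" using e C part unfolding partition_on_def disjoint_def by blast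
        then show "x \<in> \<Union>{e \<in> M. e \<subseteq> C}" using e \<open>e \<subseteq> C'\<close> by blast
      qed
      moreover have "matching E {e \<in> M. e \<subseteq> C}" using M(1) by (rule matching_subset) auto
      ultimately have "card (C \<inter> \<Union>M) \<le> 2 * card {e \<in> M. e \<subseteq> C}"
        using card_Union_matching[OF G] card_mono finite_subset[OF CV finV]
        by (metis (no_types, lifting) CV Union_matching_subset G finV finite_subset)
      moreover have "card (C - \<Union>M) \<le> 1"
        using one finite_subset[OF CV finV] by (auto simp: card_le_Suc0_iff_eq)
      moreover have "card C = card (C \<inter> \<Union>M) + card (C - \<Union>M)"
        using finite_subset[OF CV finV] by (metis Diff_Int2 Int_Diff_Un Int_commute Int_Diff_disjoint card_Un_disjoint finite_Diff finite_Int)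
      ultimately show ?thesis by linarith
    qed
    have "(\<Sum>C\<in>P. card C div 2) \<le> (\<Sum>C\<in>P. card {e \<in> M. e \<subseteq> C})" using half by (rule sum_mono)
    also have "\<dots> = card (\<Union>C\<in>P. {e \<in> M. e \<subseteq> C})"
    proof (rule card_UN_disjoint[symmetric])
      show "\<forall>C\<in>P. \<forall>D\<in>P. C \<noteq> D \<longrightarrow> {e \<in> M. e \<subseteq> C} \<inter> {e \<in> M. e \<subseteq> D} = {}"
      proof (intro ballI impI)
        fix C D assume "C \<in> P" "D \<in> P" "C \<noteq> D"
        then have "C \<inter> D = {}" using part unfolding partition_on_def disjoint_def by blast
        moreover have "e \<noteq> {}" if "e \<in> M" for e using that M G by (fastforce simp: matching_def simple_graph_def)
        ultimately show "{e \<in> M. e \<subseteq> C} \<inter> {e \<in> M. e \<subseteq> D} = {}" by blast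
      qed
    qed (use finP finM in auto)
    also have "\<dots> \<le> card M" using finM by (intro card_mono) auto
    finally show ?thesis using part edge M
      by (intro exI[of _ "{}"] exI[of _ P]) auto
  qed
qed

section \<open>Matchings in graphs of bounded edge degree\<close>

definition degree :: "'a set set \<Rightarrow> 'a \<Rightarrow> nat" where
  "degree H v = card {e \<in> H. v \<in> e}"

definition edge_degree :: "'a set set \<Rightarrow> 'a set \<Rightarrow> nat" where
  "edge_degree H e = (\<Sum>v\<in>e. degree H v)"

lemma degree_eq_card_neighbours:
  assumes "simple_graph V H"
  shows "degree H v = card {t. {v, t} \<in> H}"
proof -
  have "{e \<in> H. v \<in> e} = (\<lambda>t. {v, t}) ` {t. {v, t} \<in> H}"
  proof
    show "{e \<in> H. v \<in> e} \<subseteq> (\<lambda>t. {v, t}) ` {t. {v, t} \<in> H}"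
    proof
      fix e assume "e \<in> {e \<in> H. v \<in> e}"
      then have e: "e \<in> H" "v \<in> e" by simp_all
      obtain y where "e = {v, y}" by (rule simple_graph_edgeE[OF assms e])
      with e(1) show "e \<in> (\<lambda>t. {v, t}) ` {t. {v, t} \<in> H}" by simp
    qed
  qed auto
  moreover have "inj_on (\<lambda>t. {v, t}) {t. {v, t} \<in> H}"
    by (auto simp: inj_on_def doubleton_eq_iff)
  ultimately show ?thesis unfolding degree_def by (simp add: card_image)
qed

lemma finite_neighbours:
  assumes "simple_graph V H"
  shows "finite {t. {v, t} \<in> H}"
proof (rule finite_subset)
  show "{t. {v, t} \<in> H} \<subseteq> V" using assms by (auto simp: simple_graph_def)
  show "finite V" using assms by (simp add: simple_graph_def)
qed

text \<open>Each square lies above the tangent of \<open>x\<^sup>2\<close> at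
  \<open>\<beta> / 2\<close>, the common degree in the extremal case of the next lemma.\<close>

lemma sum_square_ge:
  fixes f :: "'b \<Rightarrow> real"
  assumes "finite S"
  shows "\<beta> * (\<Sum>s\<in>S. f s) - real (card S) * \<beta>\<^sup>2 / 4 \<le> (\<Sum>s\<in>S. (f s)\<^sup>2)"
proof -
  have "\<beta> * f s - \<beta>\<^sup>2 / 4 \<le> (f s)\<^sup>2" for s
    using zero_le_power2[of "f s - \<beta> / 2"] by (simp add: power2_eq_square algebra_simps)
  then have "(\<Sum>s\<in>S. \<beta> * f s - \<beta>\<^sup>2 / 4) \<le> (\<Sum>s\<in>S. (f s)\<^sup>2)" by (rule sum_mono)
  then show ?thesis by (simp add: sum_subtractf sum_distrib_left)
qed

text \<open>Summed over the pairs of \<open>R\<close>, the degree sums give the sum of all squared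
  degrees, which is therefore at most \<open>\<beta> * card R\<close>. The tangent bound from below
  counts \<open>\<beta> * card R\<close> once for each side, and comparing the two leaves the
  claim.\<close>

lemma bipartite_edge_bound:
  fixes R :: "('s \<times> 't) set" and \<beta> :: real
  assumes fin: "finite S" "finite T" and R: "R \<subseteq> S \<times> T" and \<beta>: "\<beta> \<ge> 0"
    and deg: "\<And>s t. (s, t) \<in> R \<Longrightarrow> real (card (R `` {s})) + real (card (R\<inverse> `` {t})) \<le> \<beta>"
  shows "4 * real (card R) \<le> \<beta> * (real (card S) + real (card T))"
proof (cases "R = {}")
  case True
  then show ?thesis using \<beta> by simp
next
  case False
  have finR: "finite R" using R fin by (meson finite_SigmaI finite_subset)
  let ?d = "\<lambda>s. real (card (R `` {s}))" and ?c = "\<lambda>t. real (card (R\<inverse> `` {t}))"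
  have R1: "R = (SIGMA s:S. R `` {s})" and R2: "R\<inverse> = (SIGMA t:T. R\<inverse> `` {t})" using R by auto
  have f1: "finite (R `` {s})" and f2: "finite (R\<inverse> `` {t})" for s t
    using finR by (auto intro: finite_Image)
  have sum1: "(\<Sum>(s, t)\<in>R. g s) = (\<Sum>s\<in>S. g s * ?d s)" for g :: "'s \<Rightarrow> real"
    by (subst R1, subst sum.Sigma[symmetric]) (use f1 fin in \<open>auto simp: mult.commute\<close>)
  have "(\<Sum>(s, t)\<in>R. g t) = (\<Sum>(t, s)\<in>R\<inverse>. g t)" for g :: "'t \<Rightarrow> real"
    by (rule sum.reindex_bij_witness[of _ prod.swap prod.swap]) auto
  moreover have "(\<Sum>(t, s)\<in>R\<inverse>. g t) = (\<Sum>t\<in>T. g t * ?c t)" for g :: "'t \<Rightarrow> real"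
    by (subst R2, subst sum.Sigma[symmetric]) (use f2 fin in \<open>auto simp: mult.commute\<close>)
  ultimately have sum2: "(\<Sum>(s, t)\<in>R. g t) = (\<Sum>t\<in>T. g t * ?c t)" for g :: "'t \<Rightarrow> real" by simp
  have c1: "real (card R) = (\<Sum>s\<in>S. ?d s)" using sum1[of "\<lambda>_. 1"] by simp
  have c2: "real (card R) = (\<Sum>t\<in>T. ?c t)" using sum2[of "\<lambda>_. 1"] by simp
  have "(\<Sum>s\<in>S. (?d s)\<^sup>2) + (\<Sum>t\<in>T. (?c t)\<^sup>2) = (\<Sum>(s, t)\<in>R. ?d s) + (\<Sum>(s, t)\<in>R. ?c t)"
    unfolding sum1 sum2 by (simp add: power2_eq_square)
  also have "\<dots> = (\<Sum>(s, t)\<in>R. ?d s + ?c t)" by (simp add: sum.distrib case_prod_beta)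
  also have "\<dots> \<le> (\<Sum>_\<in>R. \<beta>)" by (rule sum_mono) (use deg in auto)
  finally have "(\<Sum>s\<in>S. (?d s)\<^sup>2) + (\<Sum>t\<in>T. (?c t)\<^sup>2) \<le> \<beta> * real (card R)" by (simp add: mult.commute)
  with sum_square_ge[OF fin(1), of \<beta> ?d] sum_square_ge[OF fin(2), of \<beta> ?c]
  have "\<beta> * (4 * real (card R)) \<le> \<beta> * (\<beta> * (real (card S) + real (card T)))"
    unfolding c1[symmetric] c2[symmetric] by (simp add: algebra_simps power2_eq_square)
  moreover have "\<beta> > 0"
  proof -
    obtain s t where st: "(s, t) \<in> R" using False by auto
    then have "card (R `` {s}) > 0" using f1[of s] by (auto simp: card_gt_0_iff)
    then show ?thesis using deg[OF st] by linarith
  qed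
  ultimately show ?thesis by simp
qed

text \<open>
  Tutte--Berge gives a set \<open>A\<close> and parts; parts with at most \<open>D\<close> vertices absorb few edges of \<open>H\<close>,
  and a part with more than \<open>D\<close> vertices pays almost \<open>1/2\<close> per vertex. The matching edges not paid
  for lie outside \<open>Q\<close>, and their endpoints send many edges of \<open>H\<close> into the paid vertices. These
  edges are counted in the bipartite double cover, whose copies are tagged by \<open>bool\<close>.
\<close>

lemma edcs_matching_number:
  fixes D :: nat
  assumes G: "simple_graph V E" and GQ: "simple_graph V Q" and HQ: "H \<subseteq> Q" and D: "D \<ge> 12"
    and bounded: "\<And>e. e \<in> H \<Longrightarrow> edge_degree H e \<le> D\<^sup>2"
    and full: "\<And>e. e \<in> E - Q \<Longrightarrow> D\<^sup>2 \<le> edge_degree H e + D"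
  shows "(1 - 1 / real D) * real (matching_number E) \<le> (3/2 + 6 / real D) * real (matching_number Q)"
proof -
  have finV: "finite V" and GH: "simple_graph V H"
    using G simple_graph_subset[OF GQ HQ] by (auto simp: simple_graph_def)
  obtain A P where A: "A \<subseteq> V" and part: "partition_on (V - A) P"
    and inside: "\<And>e. e \<in> Q \<Longrightarrow> e \<inter> A = {} \<Longrightarrow> \<exists>C\<in>P. e \<subseteq> C"
    and TB: "card A + (\<Sum>C\<in>P. card C div 2) \<le> matching_number Q"
    using tutte_berge[OF GQ] by metis
  obtain M where M: "matching E M" "card M = matching_number E"
    using maximum_matching_exists simple_graph_finite[OF G] by blast
  have finM: "finite M" using M simple_graph_finite[OF G] by (auto simp: matching_def intro: finite_subset)
  have ME: "e \<in> E" if "e \<in> M" for e using M that by (auto simp: matching_def)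
  have UP: "\<Union>P = V - A" and disjP: "\<And>C C'. C \<in> P \<Longrightarrow> C' \<in> P \<Longrightarrow> C \<noteq> C' \<Longrightarrow> C \<inter> C' = {}"
    using part unfolding partition_on_def disjoint_def by blast+
  have finP: "finite P" using UP finV by (metis finite_Diff finite_UnionD)
  have finC: "finite C" if "C \<in> P" for C using UP finV that by (metis Union_upper finite_Diff finite_subset)
  define Ps Pl where "Ps = {C \<in> P. card C \<le> D}" and "Pl = {C \<in> P. card C > D}"
  have P_split: "P = Ps \<union> Pl" "Ps \<inter> Pl = {}" by (auto simp: Ps_def Pl_def)
  define Z L where "Z = \<Union>Ps" and "L = \<Union>Pl"
  have ZL: "Z \<union> L = V - A" using UP P_split by (auto simp: Z_def L_def)
  have ZL_disj: "Z \<inter> L = {}" using disjP by (fastforce simp: Z_def L_def Ps_def Pl_def)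
  have finZL: "finite Z" "finite L" "finite A" using ZL A finV by (metis finite_Diff finite_Un finite_subset)+
  \<comment> \<open>\<open>Mi\<close> is paid by the Tutte-Berge terms of the small parts. Of the
    rest, edges that meet \<open>A\<close> or lie inside \<open>L\<close> are paid by
    \<open>A\<close> and \<open>L\<close> alone; \<open>K\<close> is what remains.\<close>
  define Mi where "Mi = {e \<in> M. \<exists>C\<in>Ps. e \<subseteq> C}"
  define M' where "M' = M - Mi"
  define K where "K = {e \<in> M'. e \<inter> A = {} \<and> \<not> e \<subseteq> L}"
  have finM': "finite M'" "finite Mi" "finite K" using finM by (auto simp: M'_def Mi_def K_def)
  have disjM: "e = f" if "e \<in> M" "f \<in> M" "x \<in> e" "x \<in> f" for e f x
    using matching_eqI[OF M(1)] that by blast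

  have card_Mi: "card Mi \<le> (\<Sum>C\<in>Ps. card C div 2)"
  proof -
    have "Mi = (\<Union>C\<in>Ps. {e \<in> M. e \<subseteq> C})" by (auto simp: Mi_def)
    then have "card Mi \<le> (\<Sum>C\<in>Ps. card {e \<in> M. e \<subseteq> C})"
      using finP by (simp add: card_UN_le Ps_def)
    also have "\<dots> \<le> (\<Sum>C\<in>Ps. card C div 2)"
    proof (rule sum_mono)
      fix C assume "C \<in> Ps"
      then have "finite C" using finC by (auto simp: Ps_def)
      have "2 * card {e \<in> M. e \<subseteq> C} = card (\<Union>{e \<in> M. e \<subseteq> C})"
        by (rule card_Union_matching[OF G, symmetric]) (rule matching_subset[OF M(1)], auto)
      also have "\<dots> \<le> card C" by (rule card_mono[OF \<open>finite C\<close>]) auto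
      finally show "card {e \<in> M. e \<subseteq> C} \<le> card C div 2" by linarith
    qed
    finally show ?thesis .
  qed

  have K_full: "D\<^sup>2 \<le> edge_degree H e + D" if "e \<in> K" for e
  proof -
    \<comment> \<open>An edge of \<open>Q\<close> that avoids \<open>A\<close> lies in one part: a
      small part would put it into \<open>Mi\<close>, a large one inside \<open>L\<close>.\<close>
    have "e \<notin> Q"
    proof
      assume "e \<in> Q"
      then obtain C where "C \<in> P" "e \<subseteq> C" using inside[of e] \<open>e \<in> K\<close> unfolding K_def by blast
      then show False using \<open>e \<in> K\<close> P_split by (auto simp: K_def M'_def Mi_def L_def)
    qed
    then show ?thesis using full ME that by (auto simp: K_def M'_def)
  qed

  \<comment> \<open>The number of copies is four times what an edge of \<open>K\<close> still owes:
    an edge inside \<open>Z\<close> owes 1, an edge between \<open>Z\<close> and \<open>L\<close>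
    has already received 1/2 from its end in \<open>L\<close>.\<close>
  define S where "S e = (if e \<subseteq> Z then e \<times> UNIV else (e \<inter> Z) \<times> {False} \<union> (e \<inter> L) \<times> {True})"
    for e :: "'a set"
  define SS where "SS = (\<Union>e\<in>K. S e)"
  \<comment> \<open>\<open>R\<close> joins opposite tags only. A \<open>True\<close> copy of a
    vertex of \<open>L\<close> thus sees the \<open>False\<close> copies of its neighbours in
    \<open>L\<close>, and \<open>A\<close> is present for either tag. The size of \<open>T\<close>
    is twice \<open>card A + card L / 2\<close>.\<close>
  define T where "T = A \<times> UNIV \<union> L \<times> {False}"
  define R where "R = {((u, i), (t, j)). (u, i) \<in> SS \<and> (t, j) \<in> T \<and> i \<noteq> j \<and> {u, t} \<in> H}"
  have K_cases: "(\<exists>u v. e = {u, v} \<and> u \<noteq> v \<and> u \<in> Z \<and> v \<in> Z \<and> S e = {(u, True), (u, False), (v, True), (v, False)}) \<or>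
      (\<exists>u v. e = {u, v} \<and> u \<noteq> v \<and> u \<in> Z \<and> v \<in> L \<and> S e = {(u, False), (v, True)})" if "e \<in> K" for e
  proof -
    have "e \<in> E" using that ME by (auto simp: K_def M'_def)
    then have "card e = 2" "e \<subseteq> V" using G by (auto simp: simple_graph_def)
    then obtain u v where e: "e = {u, v}" "u \<noteq> v" by (auto simp: card_2_iff)
    then have "u \<in> Z \<union> L" "v \<in> Z \<union> L" using e that \<open>e \<subseteq> V\<close> ZL by (auto simp: K_def)
    moreover have "\<not> (u \<in> L \<and> v \<in> L)" using that e by (auto simp: K_def)
    ultimately consider "u \<in> Z" "v \<in> Z" | "u \<in> Z" "v \<in> L" | "v \<in> Z" "u \<in> L" by blast
    then show ?thesis
    proof cases
      case 1
      then have "S e = {(u, True), (u, False), (v, True), (v, False)}"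
        using e by (auto simp: S_def UNIV_bool)
      then show ?thesis using 1 e by blast
    next
      case 2
      then have "u \<notin> L" "v \<notin> Z" using ZL_disj by auto
      then have "S e = {(u, False), (v, True)}" using e 2 by (auto simp: S_def)
      then show ?thesis using 2 e by blast
    next
      case 3
      then have "v \<notin> L" "u \<notin> Z" using ZL_disj by auto
      then have "S e = {(v, False), (u, True)}" using e 3 by (auto simp: S_def)
      then show ?thesis using 3 e by (metis insert_commute)
    qed
  qed
  have S_fst: "fst ` S e \<subseteq> e" for e by (auto simp: S_def)
  have S_disj: "S e \<inter> S f = {}" if "e \<in> K" "f \<in> K" "e \<noteq> f" for e f
  proof (rule ccontr)
    assume "S e \<inter> S f \<noteq> {}"
    then obtain s where "s \<in> S e" "s \<in> S f" by blast
    then have "fst s \<in> e" "fst s \<in> f" using S_fst by blast+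
    moreover have "e \<in> M" "f \<in> M" using that by (simp_all add: K_def M'_def)
    ultimately show False using disjM \<open>e \<noteq> f\<close> by blast
  qed
  have finS: "finite (S e)" if "e \<in> K" for e using K_cases[OF that] by (elim disjE exE conjE) simp_all
  have finSS: "finite SS" using finS finM' by (auto simp: SS_def)
  have finT: "finite T" using finZL by (auto simp: T_def)
  have SS_cases: "u \<in> Z \<or> u \<in> L \<and> i" if ui: "(u, i) \<in> SS" for u i
  proof -
    obtain e where e: "e \<in> K" "(u, i) \<in> S e" using ui unfolding SS_def by blast
    from K_cases[OF e(1)] show ?thesis using e(2) by (elim disjE exE conjE) auto
  qed

  have deg_R: "card (R `` {(u, i)}) \<le> degree H u" for u i
  proof -
    have "R `` {(u, i)} \<subseteq> (\<lambda>t. (t, \<not> i)) ` {t. {u, t} \<in> H}" by (auto simp: R_def)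
    then show ?thesis unfolding degree_eq_card_neighbours[OF GH]
      by (rule surj_card_le[OF finite_neighbours[OF GH]])
  qed
  have deg_R': "card (R\<inverse> `` {(t, j)}) \<le> degree H t" for t j
  proof -
    have "R\<inverse> `` {(t, j)} \<subseteq> (\<lambda>u. (u, \<not> j)) ` {u. {t, u} \<in> H}" by (auto simp: R_def insert_commute)
    then show ?thesis unfolding degree_eq_card_neighbours[OF GH]
      by (rule surj_card_le[OF finite_neighbours[OF GH]])
  qed
  have R_upper: "4 * real (card R) \<le> (real D)\<^sup>2 * (real (card SS) + real (card T))"
  proof (rule bipartite_edge_bound[OF finSS finT])
    show "R \<subseteq> SS \<times> T" by (auto simp: R_def)
    fix s t assume st: "(s, t) \<in> R"
    then have e: "{fst s, fst t} \<in> H" by (auto simp: R_def)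
    then have "fst s \<noteq> fst t" using GH by (auto simp: simple_graph_def)
    then have "degree H (fst s) + degree H (fst t) \<le> D\<^sup>2"
      using bounded[OF e] by (simp add: edge_degree_def)
    then have "card (R `` {s}) + card (R\<inverse> `` {t}) \<le> D\<^sup>2"
      using deg_R[of "fst s" "snd s"] deg_R'[of "fst t" "snd t"] by simp
    then show "real (card (R `` {s})) + real (card (R\<inverse> `` {t})) \<le> (real D)\<^sup>2"
      by (metis of_nat_add of_nat_le_iff of_nat_power)
  qed simp
  have R_fin: "finite R" using finSS finT by (auto simp: R_def intro: finite_subset[of _ "SS \<times> T"])
  \<comment> \<open>The \<open>H\<close>-edges at \<open>u\<close> end in \<open>A\<close> or in the
    part of \<open>u\<close>. If that part is large, all of them are counted in \<open>R\<close>; if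
    it is small, at most \<open>D\<close> are lost.\<close>
  have R_lower: "degree H u \<le> card (R `` {(u, i)}) + D" if ui: "(u, i) \<in> SS" for u i
  proof -
    have uA: "u \<notin> A" using SS_cases[OF ui] ZL by auto
    then obtain C where C: "C \<in> P" "u \<in> C" using SS_cases[OF ui] ZL UP by blast
    have nbr: "t \<in> C" if t: "{u, t} \<in> H" "t \<notin> A" for t
    proof -
      obtain C' where "C' \<in> P" "{u, t} \<subseteq> C'" using inside[of "{u, t}"] t HQ uA by auto
      then show ?thesis using disjP[of C C'] C by auto
    qed
    have "{t. {u, t} \<in> H} \<subseteq> fst ` (R `` {(u, i)}) \<union> (if u \<in> Z then C else {})"
    proof
      fix t assume t: "t \<in> {t. {u, t} \<in> H}"
      show "t \<in> fst ` (R `` {(u, i)}) \<union> (if u \<in> Z then C else {})"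
      proof (cases "u \<in> Z \<and> t \<notin> A")
        case True
        then show ?thesis using nbr t by auto
      next
        case False
        have "(t, \<not> i) \<in> T"
        proof (cases "t \<in> A")
          case True
          then show ?thesis by (auto simp: T_def)
        next
          case tA: False
          then have "u \<notin> Z" "t \<in> C" using False nbr t by auto
          then have "i" "u \<in> L" using SS_cases[OF ui] by auto
          have "C \<in> Pl" using \<open>u \<notin> Z\<close> C P_split by (auto simp: Z_def)
          then show ?thesis using \<open>t \<in> C\<close> \<open>i\<close> by (auto simp: T_def L_def)
        qed
        then have "(t, \<not> i) \<in> R `` {(u, i)}" using t ui by (auto simp: R_def)
        then show ?thesis by force
      qed
    qed
    then have "degree H u \<le> card (fst ` (R `` {(u, i)}) \<union> (if u \<in> Z then C else {}))"
      unfolding degree_eq_card_neighbours[OF GH]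
      by (rule card_mono[rotated]) (use R_fin finC C in auto)
    also have "\<dots> \<le> card (fst ` (R `` {(u, i)})) + card (if u \<in> Z then C else {})" by (rule card_Un_le)
    also have "card (fst ` (R `` {(u, i)})) \<le> card (R `` {(u, i)})"
      using R_fin by (intro card_image_le) auto
    also have "card (if u \<in> Z then C else {}) \<le> D"
    proof (cases "u \<in> Z")
      case True
      then obtain C' where "C' \<in> Ps" "u \<in> C'" by (auto simp: Z_def)
      then have "C = C'" using disjP[of C C'] C by (auto simp: Ps_def)
      then show ?thesis using \<open>C' \<in> Ps\<close> by (auto simp: Ps_def)
    qed simp
    finally show ?thesis by simp
  qed
  let ?d = "\<lambda>s. real (card (R `` {s}))"
  \<comment> \<open>One \<open>D\<close> is the slack of \<open>K_full\<close>, the other two are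
    lost at the two ends by \<open>R_lower\<close>.\<close>
  have "((real D)\<^sup>2 - 3 * real D) * (real (card (S e)) / 2) \<le> (\<Sum>s\<in>S e. ?d s)" if e: "e \<in> K" for e
  proof -
    have lower: "real (degree H u) - real D \<le> ?d (u, i)" if "(u, i) \<in> S e" for u i
    proof -
      have "(u, i) \<in> SS" using that e by (auto simp: SS_def)
      from R_lower[OF this] show ?thesis by linarith
    qed
    have "real (D\<^sup>2) \<le> real (edge_degree H e + D)" using K_full[OF e] by (simp only: of_nat_le_iff)
    then have full': "(real D)\<^sup>2 - real D \<le> real (edge_degree H e)" by simp
    show ?thesis using K_cases[OF e]
    proof (elim disjE exE conjE)
      fix u v assume *: "e = {u, v}" "u \<noteq> v" "S e = {(u, True), (u, False), (v, True), (v, False)}"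
      have "(real D)\<^sup>2 - real D \<le> real (degree H u) + real (degree H v)"
        using full' * by (simp add: edge_degree_def)
      then show ?thesis using * lower[of u True] lower[of u False] lower[of v True] lower[of v False]
        by (simp add: algebra_simps)
    next
      fix u v assume *: "e = {u, v}" "u \<noteq> v" "S e = {(u, False), (v, True)}"
      have "(real D)\<^sup>2 - real D \<le> real (degree H u) + real (degree H v)"
        using full' * by (simp add: edge_degree_def)
      then show ?thesis using * lower[of u False] lower[of v True] by (simp add: algebra_simps)
    qed
  qed
  then have "(\<Sum>e\<in>K. ((real D)\<^sup>2 - 3 * real D) * (real (card (S e)) / 2)) \<le> (\<Sum>e\<in>K. \<Sum>s\<in>S e. ?d s)"
    by (rule sum_mono)
  moreover have "(\<Sum>e\<in>K. \<Sum>s\<in>S e. ?d s) = (\<Sum>s\<in>SS. ?d s)"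
    unfolding SS_def using finM' finS S_disj by (intro sum.UNION_disjoint[symmetric]) auto
  moreover have "(\<Sum>s\<in>SS. ?d s) = real (card R)"
  proof -
    have "R = (SIGMA s:SS. R `` {s})" by (auto simp: R_def)
    then have "card R = (\<Sum>s\<in>SS. card (R `` {s}))"
      using card_SigmaI[OF finSS, of "\<lambda>s. R `` {s}"] R_fin by (metis finite_Image)
    then show ?thesis by simp
  qed
  moreover have card_SS: "real (card SS) = (\<Sum>e\<in>K. real (card (S e)))"
    unfolding SS_def using finM' finS S_disj by (subst card_UN_disjoint) auto
  ultimately have R_low: "((real D)\<^sup>2 - 3 * real D) * (real (card SS) / 2) \<le> real (card R)"
    by (simp add: sum_distrib_left sum_divide_distrib)

  \<comment> \<open>With \<open>R_upper\<close> the \<open>card SS\<close> terms partly cancel: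
    \<open>2 * (D\<^sup>2 - 3 * D) - D\<^sup>2\<close> is \<open>D * (D - 6)\<close>.\<close>
  have "real D * ((real D - 6) * real (card SS)) \<le> real D * (real D * real (card T))"
    using R_low R_upper by (simp add: algebra_simps power2_eq_square)
  then have SS_T: "(real D - 6) * real (card SS) \<le> real D * real (card T)" using D by simp

  \<comment> \<open>This is the Tutte-Berge weight of \<open>A\<close> and the large parts, without
    the rounding.\<close>
  define Y where "Y = real (card A) + real (card L) / 2"
  have card_T: "real (card T) \<le> 2 * Y"
  proof -
    have "card T \<le> card (A \<times> (UNIV :: bool set)) + card (L \<times> {False})"
      unfolding T_def by (rule card_Un_le)
    then show ?thesis by (simp add: Y_def card_cartesian_product)
  qed
  have card_part: "(\<Sum>e\<in>M'. card (e \<inter> X)) \<le> card X" if "finite X" for X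
  proof -
    have "(\<Sum>e\<in>M'. card (e \<inter> X)) = card (\<Union>e\<in>M'. e \<inter> X)"
      using that finM' disjM by (intro card_UN_disjoint[symmetric]) (auto simp: M'_def)
    also have "\<dots> \<le> card X" using that by (intro card_mono) auto
    finally show ?thesis .
  qed
  have pay: "1 \<le> real (card (e \<inter> A)) + real (card (e \<inter> L)) / 2 + (if e \<in> K then real (card (S e)) / 4 else 0)"
    if e: "e \<in> M'" for e
  proof -
    consider "e \<inter> A \<noteq> {}" | "e \<subseteq> L" | "e \<in> K" using e by (auto simp: K_def)
    then show ?thesis
    proof cases
      case 1
      then have "card (e \<inter> A) \<ge> 1" using finZL by (simp add: Suc_le_eq card_gt_0_iff)
      then show ?thesis by simp
    next
      case 2
      then have "e \<inter> L = e" by blast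
      then have "card (e \<inter> L) = 2" using e ME G by (auto simp: M'_def simple_graph_def)
      then show ?thesis by simp
    next
      case 3
      then show ?thesis using K_cases[OF 3]
      proof (elim disjE exE conjE)
        fix u v assume *: "e = {u, v}" "u \<noteq> v" "S e = {(u, True), (u, False), (v, True), (v, False)}"
        then show ?thesis using 3 by simp
      next
        fix u v assume *: "e = {u, v}" "u \<noteq> v" "u \<in> Z" "v \<in> L" "S e = {(u, False), (v, True)}"
        then have "e \<inter> L = {v}" using ZL_disj by auto
        then show ?thesis using 3 * by simp
      qed
    qed
  qed
  have "real (card M') = (\<Sum>e\<in>M'. 1)" by simp
  also have "\<dots> \<le> (\<Sum>e\<in>M'. real (card (e \<inter> A)) + real (card (e \<inter> L)) / 2 + (if e \<in> K then real (card (S e)) / 4 else 0))"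
    using pay by (rule sum_mono)
  also have "\<dots> = real (\<Sum>e\<in>M'. card (e \<inter> A)) + real (\<Sum>e\<in>M'. card (e \<inter> L)) / 2 + (\<Sum>e\<in>K. real (card (S e)) / 4)"
    using finM' by (simp add: sum.distrib sum_divide_distrib sum.inter_restrict[symmetric] K_def Int_def flip: sum.inter_filter)
  also have "\<dots> \<le> Y + real (card SS) / 4"
    using of_nat_mono[OF card_part[OF finZL(3)], where 'a = real]
      of_nat_mono[OF card_part[OF finZL(2)], where 'a = real]
    unfolding Y_def card_SS sum_divide_distrib[symmetric] by linarith
  finally have M'_bound: "real (card M') \<le> Y + real (card SS) / 4" .

  define w where "w = 1 / real D"
  have w: "w > 0" "w \<le> 1 / 12" using D by (auto simp: w_def field_simps)
  \<comment> \<open>Rounding loses at most 1/2 per part, which is at most a share \<open>w\<close>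
    of half the size of a part with more than \<open>D\<close> vertices.\<close>
  have large: "(1 - w) * (real (card L) / 2) \<le> real (\<Sum>C\<in>Pl. card C div 2)"
  proof -
    have "real (card L) = (\<Sum>C\<in>Pl. real (card C))"
      unfolding L_def using finC disjP by (subst card_Union_disjoint) (auto simp: Pl_def pairwise_def disjnt_def)
    moreover have "(1 - w) * (real (card C) / 2) \<le> real (card C div 2)" if "C \<in> Pl" for C
    proof -
      have "real D \<le> real (card C)" using that by (auto simp: Pl_def)
      then have "1 \<le> w * real (card C)" using D by (simp add: w_def field_simps)
      moreover have "real (card C) - 1 \<le> 2 * real (card C div 2)" by linarith
      ultimately show ?thesis by (simp add: algebra_simps)
    qed
    ultimately show ?thesis by (simp add: sum_distrib_left sum_divide_distrib sum_mono)
  qed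
  have "(\<Sum>C\<in>P. card C div 2) = (\<Sum>C\<in>Ps. card C div 2) + (\<Sum>C\<in>Pl. card C div 2)"
    using finP P_split by (metis finite_Un sum.union_disjoint)
  then have "real (card A) + real (\<Sum>C\<in>Ps. card C div 2) + real (\<Sum>C\<in>Pl. card C div 2) \<le> real (matching_number Q)"
    using TB by linarith
  moreover have "(1 - w) * real (card A) \<le> real (card A)" using w by (simp add: algebra_simps)
  ultimately have Y_bound: "(1 - w) * Y + real (card Mi) \<le> real (matching_number Q)"
    using large of_nat_mono[OF card_Mi, where 'a = real] unfolding Y_def by argo
  have card_M: "real (matching_number E) = real (card Mi) + real (card M')"
  proof -
    have "card M = card Mi + card M'"
      using card_Un_disjoint[of Mi M'] finM' by (auto simp: M'_def Mi_def Un_absorb1 Un_Diff_cancel)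
    then show ?thesis using M by simp
  qed
  have Y0: "Y \<ge> 0" by (simp add: Y_def)
  have "(1 - 6 * w) * real (card SS) \<le> 2 * Y"
  proof -
    have "real D * ((1 - 6 * w) * real (card SS)) \<le> real D * real (card T)"
    proof -
      have "real D * (1 - 6 * w) = real D - 6" using D by (simp add: w_def field_simps)
      then show ?thesis using SS_T by (metis mult.assoc)
    qed
    then show ?thesis using card_T D by simp
  qed
  \<comment> \<open>This linear bound for \<open>1 / (1 - 6 * w)\<close> is where
    \<open>w \<le> 1 / 12\<close>, that is \<open>D \<ge> 12\<close>, comes from.\<close>
  moreover have "1 \<le> (1 - 6 * w) * (1 + 12 * w)"
  proof -
    have "0 \<le> 6 * w * (1 - 12 * w)" using w by (intro mult_nonneg_nonneg) auto
    then show ?thesis by (simp add: algebra_simps)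
  qed
  ultimately have "real (card SS) \<le> (1 + 12 * w) * (2 * Y)"
  proof -
    assume 1: "(1 - 6 * w) * real (card SS) \<le> 2 * Y" and 2: "1 \<le> (1 - 6 * w) * (1 + 12 * w)"
    have "real (card SS) \<le> ((1 - 6 * w) * (1 + 12 * w)) * real (card SS)"
      using 2 mult_right_mono[OF 2, of "real (card SS)"] by simp
    also have "\<dots> = (1 + 12 * w) * ((1 - 6 * w) * real (card SS))" by simp
    also have "\<dots> \<le> (1 + 12 * w) * (2 * Y)" using 1 w by (intro mult_left_mono) auto
    finally show ?thesis .
  qed
  \<comment> \<open>The 3/2 arises here: \<open>Y\<close> pays once directly, and
    \<open>card SS / 4\<close> is at most about \<open>Y / 2\<close>.\<close>
  then have "real (card M') \<le> (3/2 + 6 * w) * Y" using M'_bound by (simp add: algebra_simps)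
  then have "(1 - w) * real (matching_number E) \<le> (1 - w) * (real (card Mi) + (3/2 + 6 * w) * Y)"
    using w card_M by (intro mult_left_mono) auto
  also have "\<dots> = (1 - w) * real (card Mi) + (3/2 + 6 * w) * ((1 - w) * Y)"
    by (simp only: distrib_left mult.left_commute)
  also have "\<dots> \<le> (3/2 + 6 * w) * real (card Mi) + (3/2 + 6 * w) * ((1 - w) * Y)"
    using w Y0 by (intro add_mono mult_right_mono) auto
  also have "\<dots> = (3/2 + 6 * w) * ((1 - w) * Y + real (card Mi))"
    by (simp only: distrib_left add.commute)
  also have "\<dots> \<le> (3/2 + 6 * w) * real (matching_number Q)"
    using Y_bound w by (intro mult_left_mono) auto
  finally show ?thesis by (simp add: w_def)
qed

section \<open>Random orders\<close>

lemma prob_random_order: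
  assumes "finite E"
  shows "measure_pmf.prob (random_order E) X = real (card (permutations_of_set E \<inter> X)) / fact (card E)"
  using assms by (simp add: random_order_def measure_pmf_of_set)

lemma prob_random_order_Cons:
  assumes "finite E" "E \<noteq> {}"
  shows "measure_pmf.prob (random_order E) {es. P es} =
         (\<Sum>x\<in>E. measure_pmf.prob (random_order (E - {x})) {es. P (x # es)}) / real (card E)"
proof -
  define F where "F x = permutations_of_set (E - {x}) \<inter> {es. P (x # es)}" for x
  have "permutations_of_set E \<inter> {es. P es} = (\<Union>x\<in>E. (#) x ` F x)"
    using assms by (subst permutations_of_set_nonempty) (auto simp: F_def)
  then have "card (permutations_of_set E \<inter> {es. P es}) = (\<Sum>x\<in>E. card ((#) x ` F x))"
    using assms by (simp only:) (intro card_UN_disjoint, auto simp: F_def)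
  also have "\<dots> = (\<Sum>x\<in>E. card (F x))" by (simp add: card_image)
  finally have "real (card (permutations_of_set E \<inter> {es. P es})) = (\<Sum>x\<in>E. real (card (F x)))" by simp
  moreover have "card E = Suc (card E - 1)" using assms by (simp add: card_gt_0_iff)
  then have "(fact (card E) :: real) = real (card E) * fact (card E - 1)" by (metis fact_Suc of_nat_fact of_nat_mult)
  moreover have "measure_pmf.prob (random_order (E - {x})) {es. P (x # es)} = real (card (F x)) / fact (card E - 1)"
    if "x \<in> E" for x using assms that by (simp add: prob_random_order F_def)
  ultimately show ?thesis
    using assms by (simp add: prob_random_order sum_divide_distrib[symmetric] divide_simps)
qed

lemma prob_random_order_mono:
  assumes "finite E" "\<And>es. distinct es \<Longrightarrow> set es = E \<Longrightarrow> P es \<Longrightarrow> Q es"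
  shows "measure_pmf.prob (random_order E) {es. P es} \<le> measure_pmf.prob (random_order E) {es. Q es}"
  using assms
  by (auto simp: prob_random_order permutations_of_set_def intro!: divide_right_mono card_mono finite_subset[OF _ finite_permutations_of_set[of E]])

text \<open>Conditioned on its first \<open>p\<close> elements, the rest of a random order is a
  random order of the remaining elements, so a bound that holds for every prefix averages to the
  same bound.\<close>

lemma prob_random_order_prefix:
  assumes "finite E" "p \<le> card E"
    and "\<And>xs. distinct xs \<Longrightarrow> set xs \<subseteq> E \<Longrightarrow> length xs = p \<Longrightarrow>
           measure_pmf.prob (random_order (E - set xs)) {ys. Q xs ys} \<le> \<delta>"
  shows "measure_pmf.prob (random_order E) {es. Q (take p es) (drop p es)} \<le> \<delta>"
  using assms
proof (induction p arbitrary: E Q)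
  case 0
  then show ?case using "0.prems"(3)[of "[]"] by simp
next
  case (Suc p)
  have fin: "finite E" and card: "Suc p \<le> card E" by fact+
  then have "E \<noteq> {}" by auto
  have "measure_pmf.prob (random_order (E - {x})) {es. Q (take (Suc p) (x # es)) (drop (Suc p) (x # es))} \<le> \<delta>"
    if "x \<in> E" for x
  proof -
    have "measure_pmf.prob (random_order (E - {x})) {es. (\<lambda>xs. Q (x # xs)) (take p es) (drop p es)} \<le> \<delta>"
    proof (rule Suc.IH)
      fix xs assume xs: "distinct xs" "set xs \<subseteq> E - {x}" "length xs = p"
      have "measure_pmf.prob (random_order (E - set (x # xs))) {ys. Q (x # xs) ys} \<le> \<delta>"
        using xs that by (intro Suc.prems(3)) auto
      then show "measure_pmf.prob (random_order (E - {x} - set xs)) {ys. Q (x # xs) ys} \<le> \<delta>"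
        by (simp only: list.set(2) Diff_insert2[of E x "set xs"])
    qed (use fin card that in auto)
    then show ?thesis by simp
  qed
  then have "(\<Sum>x\<in>E. measure_pmf.prob (random_order (E - {x}))
      {es. Q (take (Suc p) (x # es)) (drop (Suc p) (x # es))}) \<le> real (card E) * \<delta>"
    by (rule sum_bounded_above)
  then show ?case
    using card by (subst prob_random_order_Cons[OF fin \<open>E \<noteq> {}\<close>]) (simp add: divide_le_eq mult.commute)
qed

text \<open>A draw outside \<open>B\<close> leaves \<open>B\<close> intact and the ground set
  smaller, so each draw misses \<open>B\<close> with probability at most
  \<open>1 - card B / m\<close>. The fixed bound \<open>m\<close> on the size survives the
  induction, in which \<open>E\<close> shrinks.\<close>

lemma prob_random_order_avoid:
  assumes "finite E" "B \<subseteq> E" "card E \<le> m"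
  shows "measure_pmf.prob (random_order E) {es. set (take a es) \<inter> B = {}}
           \<le> exp (- (real a * real (card B) / real m))"
  using assms
proof (induction a arbitrary: E)
  case 0
  then show ?case by simp
next
  case (Suc a)
  show ?case
  proof (cases "B = {}")
    case False
    then have "E \<noteq> {}" "card E > 0" using Suc.prems by (auto simp: card_gt_0_iff)
    have finB: "finite B" using Suc.prems finite_subset by blast
    let ?q = "exp (- (real a * real (card B) / real m))"
    have "measure_pmf.prob (random_order (E - {x})) {es. set (take (Suc a) (x # es)) \<inter> B = {}}
        \<le> (if x \<in> B then 0 else ?q)" if x: "x \<in> E" for x
    proof (cases "x \<in> B")
      case False
      have "card (E - {x}) \<le> m" using Suc.prems by (meson card_Diff1_le order_trans)
      then show ?thesis using Suc.IH[of "E - {x}"] Suc.prems False by auto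
    qed simp
    then have "(\<Sum>x\<in>E. measure_pmf.prob (random_order (E - {x})) {es. set (take (Suc a) (x # es)) \<inter> B = {}})
        \<le> (\<Sum>x\<in>E. if x \<in> B then 0 else ?q)" by (rule sum_mono)
    also have "\<dots> = real (card (E - B)) * ?q"
      using Suc.prems by (simp add: sum.If_cases Diff_eq)
    also have "real (card (E - B)) = real (card E) - real (card B)"
      using Suc.prems finB by (simp add: card_Diff_subset card_mono of_nat_diff)
    finally have "measure_pmf.prob (random_order E) {es. set (take (Suc a) es) \<inter> B = {}}
        \<le> (1 - real (card B) / real (card E)) * ?q"
      using Suc.prems \<open>E \<noteq> {}\<close> \<open>card E > 0\<close>
      by (subst prob_random_order_Cons) (auto simp: field_simps)
    also have "\<dots> \<le> exp (- (real (card B) / real m)) * ?q"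
    proof (rule mult_right_mono)
      have "1 - real (card B) / real (card E) \<le> 1 - real (card B) / real m"
        using Suc.prems \<open>card E > 0\<close> by (simp add: frac_le)
      also have "\<dots> \<le> exp (- (real (card B) / real m))"
        using exp_ge_add_one_self[of "- (real (card B) / real m)"] by simp
      finally show "1 - real (card B) / real (card E) \<le> exp (- (real (card B) / real m))" .
    qed simp
    also have "\<dots> = exp (- (real (Suc a) * real (card B) / real m))"
      by (simp add: mult_exp_exp algebra_simps add_divide_distrib)
    finally show ?thesis .
  qed simp
qed

text \<open>For \<open>k \<le> card E\<close> the probability is the quotient of the two binomials.
  The inequality in product form holds for all \<open>k\<close>, and the induction, split by whether
  the first element lies in \<open>B\<close>, ends in Pascal's rule.\<close>

lemma prob_random_order_subset_prefix:
  assumes "finite E" "B \<subseteq> E"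
  shows "measure_pmf.prob (random_order E) {es. B \<subseteq> set (take k es)} * real (card E choose card B)
           \<le> real (k choose card B)"
  using assms
proof (induction k arbitrary: E B)
  case 0
  show ?case
  proof (cases "B = {}")
    case False
    then have "card B > 0" using 0 by (metis card_gt_0_iff finite_subset)
    then show ?thesis using False by simp
  qed simp
next
  case (Suc k)
  have finB: "finite B" using Suc.prems finite_subset by blast
  show ?case
  proof (cases "B = {}")
    case False
    then have "E \<noteq> {}" using Suc.prems by auto
    obtain b where b: "card B = Suc b" using False finB by (metis card_gt_0_iff gr0_implies_Suc)
    obtain m where m: "card E = Suc m" using \<open>E \<noteq> {}\<close> Suc.prems by (metis card_gt_0_iff gr0_implies_Suc)
    let ?p = "\<lambda>x. measure_pmf.prob (random_order (E - {x})) {es. B \<subseteq> set (take (Suc k) (x # es))}"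
    let ?c = "real (Suc m choose Suc b)"
    \<comment> \<open>Absorption identities: they replace the binomial of \<open>E\<close> by those
      of \<open>E - {x}\<close>, once with \<open>x\<close> removed from \<open>B\<close> and once
      with \<open>B\<close> kept.\<close>
    have c1: "real (Suc b) * ?c = real (Suc m) * real (m choose b)"
      by (metis Suc_times_binomial_eq mult.commute of_nat_mult)
    have c2: "(real m - real b) * ?c = real (Suc m) * real (m choose Suc b)"
    proof (cases "b \<le> m")
      case True
      then show ?thesis
        using arg_cong[OF binomial_absorb_comp[of "Suc m" "Suc b"], of real]
        by (simp add: of_nat_diff algebra_simps del: binomial_Suc_Suc)
    qed (simp add: binomial_eq_0)
    have frac: "p * c / n2 \<le> r / n1"
      if "n1 * c = n2 * q" "n1 > 0" "n2 > 0" "p * q \<le> r" for p c q r n1 n2 :: real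
    proof -
      have "c / n2 = q / n1" using that by (simp add: frac_eq_eq mult.commute)
      then have "p * c / n2 = p * q / n1" by (metis times_divide_eq_right)
      then show ?thesis using that by (simp add: divide_right_mono)
    qed
    have 1: "?p x * ?c / real (Suc m) \<le> real (k choose b) / real (Suc b)" if "x \<in> B" for x
    proof -
      have "?p x = measure_pmf.prob (random_order (E - {x})) {es. B - {x} \<subseteq> set (take k es)}"
        by (intro arg_cong[where f = "measure_pmf.prob _"]) auto
      moreover have "card (B - {x}) = b" "card (E - {x}) = m"
        using that b m finB Suc.prems by auto
      ultimately have "?p x * real (m choose b) \<le> real (k choose b)"
        using Suc.IH[of "E - {x}" "B - {x}"] Suc.prems by (auto simp del: take_Suc_Cons)
      then show ?thesis by (intro frac[OF c1]) simp_all
    qed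
    have 2: "?p x * ?c / real (Suc m) \<le> real (k choose Suc b) / (real m - real b)" if "x \<in> E - B" for x
    proof -
      have "?p x = measure_pmf.prob (random_order (E - {x})) {es. B \<subseteq> set (take k es)}"
        using that by (intro arg_cong[where f = "measure_pmf.prob _"]) auto
      moreover have "card (E - {x}) = m" using that m by auto
      ultimately have "?p x * real (m choose Suc b) \<le> real (k choose Suc b)"
        using Suc.IH[of "E - {x}" B] Suc.prems b that by (auto simp del: take_Suc_Cons)
      moreover have "b < m"
        using that b m Suc.prems finB psubset_card_mono[of E B] by auto
      ultimately show ?thesis by (intro frac[OF c2]) simp_all
    qed
    have "measure_pmf.prob (random_order E) {es. B \<subseteq> set (take (Suc k) es)} * ?c
        = (\<Sum>x\<in>E. ?p x * ?c / real (Suc m))"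
      using Suc.prems \<open>E \<noteq> {}\<close> m
      by (subst prob_random_order_Cons)
        (auto simp: sum_divide_distrib sum_distrib_right simp del: binomial_Suc_Suc of_nat_Suc take_Suc_Cons intro!: sum.cong)
    also have "\<dots> = (\<Sum>x\<in>B. ?p x * ?c / real (Suc m)) + (\<Sum>x\<in>E - B. ?p x * ?c / real (Suc m))"
      using Suc.prems by (metis (no_types, lifting) add.commute sum.subset_diff)
    also have "\<dots> \<le> (\<Sum>x\<in>B. real (k choose b) / real (Suc b)) + (\<Sum>x\<in>E - B. real (k choose Suc b) / (real m - real b))"
      using 1 2 by (intro add_mono sum_mono) auto
    also have "(\<Sum>x\<in>B. real (k choose b) / real (Suc b)) = real (k choose b)"
      using b by (simp del: of_nat_Suc)
    also have "(\<Sum>x\<in>E - B. real (k choose Suc b) / (real m - real b)) \<le> real (k choose Suc b)"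
    proof -
      have "real (card (E - B)) = real m - real b"
        using Suc.prems finB b m card_mono[of E B] by (simp add: card_Diff_subset of_nat_diff)
      then show ?thesis by simp
    qed
    finally show ?thesis using b m by simp
  qed simp
qed

text \<open>Factor by factor, \<open>(k - i) / (m - i) \<le> k / m\<close>.\<close>

lemma binomial_ratio_le:
  assumes "k \<le> m"
  shows "real (k choose a) * real m ^ a \<le> real (m choose a) * real k ^ a"
proof (induction a)
  case (Suc a)
  have step: "real (Suc a) * real (n choose Suc a) = real (n - a) * real (n choose a)" for n
    by (metis binomial_absorb_comp binomial_absorption of_nat_mult)
  have "real (k - a) * real m \<le> real (m - a) * real k"
  proof (cases "a \<le> k")
    case True
    then show ?thesis using assms by (simp add: of_nat_diff algebra_simps mult_left_mono)
  qed simp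
  from mult_mono[OF Suc.IH this]
  have "(real (k choose a) * real m ^ a) * (real (k - a) * real m)
      \<le> (real (m choose a) * real k ^ a) * (real (m - a) * real k)"
    by simp
  then have "(real (k - a) * real (k choose a)) * real m ^ Suc a
      \<le> (real (m - a) * real (m choose a)) * real k ^ Suc a"
    by (simp add: algebra_simps)
  then have "real (Suc a) * (real (k choose Suc a) * real m ^ Suc a)
      \<le> real (Suc a) * (real (m choose Suc a) * real k ^ Suc a)"
    unfolding step[symmetric] by (simp only: mult.assoc)
  then show ?case by (simp only: mult_le_cancel_left_pos of_nat_0_less_iff zero_less_Suc)
qed simp

text \<open>\<open>a ^ a / fact a\<close> is a single term of the series of \<open>exp a\<close>,
  and \<open>exp 1\<close> is at most 3.\<close>

lemma power_self_le_fact: "real a ^ a \<le> 3 ^ a * fact a"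
proof -
  have "(\<Sum>i\<in>{a}. real a ^ i /\<^sub>R fact i) \<le> (\<Sum>i. real a ^ i /\<^sub>R fact i)"
    by (intro sum_le_suminf sums_summable[OF exp_converges]) auto
  also have "\<dots> = exp (real a)" using sums_unique[OF exp_converges[of "real a"]] by simp
  also have "\<dots> = exp 1 ^ a" by (metis exp_of_nat_mult mult.right_neutral)
  also have "\<dots> \<le> 3 ^ a" by (intro power_mono exp_le) simp
  finally show ?thesis by (simp add: field_simps scaleR_conv_of_real)
qed

text \<open>A union bound over the \<open>a\<close>-subsets of \<open>M\<close> stands in for a
  Chernoff bound for sampling without replacement. The 3 bounds \<open>exp 1\<close> in the usual
  estimate of \<open>card M choose a\<close>.\<close>

lemma prob_random_order_prefix_hits:
  assumes "finite E" "M \<subseteq> E" "k \<le> card E" "a > 0"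
  shows "measure_pmf.prob (random_order E) {es. a \<le> card (M \<inter> set (take k es))}
           \<le> (3 * real (card M) * real k / (real a * real (card E))) ^ a"
proof -
  have finM: "finite M" using assms finite_subset by blast
  define \<B> where "\<B> = {B. B \<subseteq> M \<and> card B = a}"
  have fin\<B>: "finite \<B>" using finM by (auto simp: \<B>_def)
  have "{es. a \<le> card (M \<inter> set (take k es))} \<subseteq> (\<Union>B\<in>\<B>. {es. B \<subseteq> set (take k es)})"
  proof
    fix es assume "es \<in> {es. a \<le> card (M \<inter> set (take k es))}"
    then obtain B where "B \<subseteq> M \<inter> set (take k es)" "card B = a"
      using obtain_subset_with_card_n by (metis mem_Collect_eq)
    then show "es \<in> (\<Union>B\<in>\<B>. {es. B \<subseteq> set (take k es)})" by (auto simp: \<B>_def)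
  qed
  then have "measure_pmf.prob (random_order E) {es. a \<le> card (M \<inter> set (take k es))}
      \<le> measure_pmf.prob (random_order E) (\<Union>B\<in>\<B>. {es. B \<subseteq> set (take k es)})"
    by (intro measure_pmf.finite_measure_mono) auto
  also have "\<dots> \<le> (\<Sum>B\<in>\<B>. measure_pmf.prob (random_order E) {es. B \<subseteq> set (take k es)})"
    using fin\<B> by (intro measure_pmf.finite_measure_subadditive_finite) auto
  also have "\<dots> \<le> (\<Sum>B\<in>\<B>. (real k / real (card E)) ^ a)"
  proof (rule sum_mono)
    fix B assume "B \<in> \<B>"
    then have B: "B \<subseteq> E" "card B = a" using assms by (auto simp: \<B>_def)
    then have "a \<le> card E" using assms card_mono by blast
    then have pos: "real (card E choose a) > 0" "real (card E) > 0" using assms by auto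
    have "measure_pmf.prob (random_order E) {es. B \<subseteq> set (take k es)} * real (card E choose a) \<le> real (k choose a)"
      using prob_random_order_subset_prefix[OF assms(1) B(1)] B(2) by simp
    then have "measure_pmf.prob (random_order E) {es. B \<subseteq> set (take k es)} \<le> real (k choose a) / real (card E choose a)"
      using pos by (simp add: field_simps)
    also have "\<dots> \<le> real k ^ a / real (card E) ^ a"
      using binomial_ratio_le[OF assms(3), of a] pos by (simp add: field_simps)
    finally show "measure_pmf.prob (random_order E) {es. B \<subseteq> set (take k es)} \<le> (real k / real (card E)) ^ a"
      by (simp add: power_divide)
  qed
  also have "\<dots> = real (card M choose a) * (real k / real (card E)) ^ a"
    using n_subsets[OF finM] by (simp add: \<B>_def)
  also have "\<dots> \<le> (3 * real (card M) / real a) ^ a * (real k / real (card E)) ^ a"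
  proof (rule mult_right_mono)
    have "real (card M choose a) * fact a \<le> real (card M) ^ a"
      using binomial_fact_pow[of "card M" a] by (metis of_nat_fact of_nat_le_iff of_nat_mult of_nat_power)
    then have "real (card M choose a) * (real a ^ a) * fact a \<le> real (card M) ^ a * (3 ^ a * fact a)"
      using power_self_le_fact[of a] mult_mono[of "real (card M choose a) * fact a" "real (card M) ^ a" "real a ^ a" "3 ^ a * fact a"]
      by (simp add: mult_ac)
    then have "real (card M choose a) * (real a ^ a) \<le> real (card M) ^ a * 3 ^ a" by simp
    then show "real (card M choose a) \<le> (3 * real (card M) / real a) ^ a"
      using assms(4) by (simp add: power_divide power_mult_distrib field_simps)
  qed simp
  also have "\<dots> = (3 * real (card M) * real k / (real a * real (card E))) ^ a"
    by (simp add: power_mult_distrib[symmetric])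
  finally show ?thesis .
qed

section \<open>Maintaining the subgraph along the stream\<close>

text \<open>
  An edge that is overfull (degree sum above \<open>D\<^sup>2\<close>) raises the potential when it is deleted, an edge
  that is underfull (degree sum below \<open>D\<^sup>2 - D\<close>) raises it when it is inserted.
\<close>

definition potential :: "'a set \<Rightarrow> nat \<Rightarrow> 'a set set \<Rightarrow> int" where
  "potential V D H = (2 * int D ^ 2 - int D) * int (card H) - (\<Sum>v\<in>V. int (degree H v) ^ 2)"

definition improving :: "'a set \<Rightarrow> nat \<Rightarrow> 'a set set \<Rightarrow> 'a set \<Rightarrow> bool" where
  "improving V D H e \<longleftrightarrow> potential V D H < potential V D (insert e H)"

definition stable :: "'a set \<Rightarrow> nat \<Rightarrow> 'a set set \<Rightarrow> bool" where
  "stable V D H \<longleftrightarrow> (\<forall>e\<in>H. potential V D (H - {e}) \<le> potential V D H)"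

text \<open>One global maximization replaces an insertion followed by deletions of overfull edges:
  \<open>stable\<close> and the gain in potential are then immediate. Only memory is measured, so
  the cost of this search does not matter.\<close>

definition improve :: "'a set \<Rightarrow> nat \<Rightarrow> 'a set set \<Rightarrow> 'a set \<Rightarrow> 'a set set" where
  "improve V D H e = arg_max (potential V D) (\<lambda>H'. H' \<subseteq> insert e H)"

lemma degree_insert:
  assumes "finite H" "e \<notin> H"
  shows "degree (insert e H) v = degree H v + (if v \<in> e then 1 else 0)"
proof -
  have "{f \<in> insert e H. v \<in> f} = (if v \<in> e then insert e {f \<in> H. v \<in> f} else {f \<in> H. v \<in> f})" by auto
  then show ?thesis using assms by (simp add: degree_def)
qed

text \<open>Inserting \<open>e\<close> adds \<open>2 * degree H v + 1\<close> to the squares at each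
  end \<open>v\<close>. So the gain changes sign at degree sum \<open>D\<^sup>2 - D / 2 - 1\<close>,
  which for \<open>D \<ge> 2\<close> lies between the thresholds \<open>D\<^sup>2 - D\<close> and
  \<open>D\<^sup>2\<close>, with room for the shift by 2 when \<open>e\<close> itself is
  counted.\<close>

lemma potential_insert:
  assumes G: "simple_graph V (insert e H)" and e: "e \<notin> H"
  shows "potential V D (insert e H) = potential V D H + 2 * int D ^ 2 - int D - 2 * int (edge_degree H e) - 2"
proof -
  have finH: "finite H" and finV: "finite V" and eV: "e \<subseteq> V" "card e = 2"
    using G simple_graph_finite[OF G] by (auto simp: simple_graph_def)
  have "(\<Sum>v\<in>V. int (degree (insert e H) v) ^ 2)
      = (\<Sum>v\<in>V. int (degree H v) ^ 2 + (if v \<in> e then 2 * int (degree H v) + 1 else 0))"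
    by (intro sum.cong) (auto simp: degree_insert[OF finH e] power2_eq_square algebra_simps)
  also have "\<dots> = (\<Sum>v\<in>V. int (degree H v) ^ 2) + (\<Sum>v\<in>e. 2 * int (degree H v) + 1)"
    using finV eV by (simp add: sum.distrib sum.inter_restrict[symmetric] Int_absorb1)
  also have "(\<Sum>v\<in>e. 2 * int (degree H v) + 1) = 2 * int (edge_degree H e) + 2"
    using eV by (simp add: sum.distrib edge_degree_def sum_distrib_left)
  finally show ?thesis using finH e by (simp add: potential_def algebra_simps)
qed

lemma edge_degree_insert:
  assumes "simple_graph V (insert e H)" "e \<notin> H"
  shows "edge_degree (insert e H) e = edge_degree H e + 2"
proof -
  have "finite H" "card e = 2" using assms simple_graph_finite[OF assms(1)] by (auto simp: simple_graph_def)
  then show ?thesis using assms(2)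
    by (simp add: edge_degree_def degree_insert sum_Suc)
qed

lemma edge_degree_le_if_stable:
  assumes G: "simple_graph V H" and "stable V D H" "e \<in> H" "D \<ge> 1"
  shows "edge_degree H e \<le> D\<^sup>2"
proof -
  have H: "insert e (H - {e}) = H" using assms by auto
  have "potential V D (H - {e}) \<le> potential V D H" using assms by (auto simp: stable_def)
  moreover have "potential V D H = potential V D (H - {e}) + 2 * int D ^ 2 - int D - 2 * int (edge_degree (H - {e}) e) - 2"
    using potential_insert[of V e "H - {e}" D] G H by simp
  moreover have "edge_degree H e = edge_degree (H - {e}) e + 2"
    using edge_degree_insert[of V e "H - {e}"] G H by simp
  ultimately have "int (edge_degree H e) \<le> int D ^ 2" using \<open>D \<ge> 1\<close> by linarith
  then show ?thesis by (metis of_nat_le_iff of_nat_power)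
qed

lemma edge_degree_ge_if_not_improving:
  assumes G: "simple_graph V (insert e H)" and "\<not> improving V D H e" "e \<notin> H" "D \<ge> 2"
  shows "D\<^sup>2 \<le> edge_degree H e + D"
proof -
  have "int D ^ 2 \<le> int (edge_degree H e) + int D"
    using potential_insert[OF G assms(3), of D] assms unfolding improving_def by linarith
  then show ?thesis by (metis of_nat_add of_nat_le_iff of_nat_power)
qed

lemma sum_degree:
  assumes "simple_graph V H"
  shows "(\<Sum>v\<in>V. degree H v) = 2 * card H"
proof -
  have finV: "finite V" and finH: "finite H" using assms simple_graph_finite by (auto simp: simple_graph_def)
  have "(\<Sum>v\<in>V. degree H v) = (\<Sum>v\<in>V. \<Sum>e\<in>H. if v \<in> e then 1 else 0)"
    using finH by (simp add: degree_def sum.If_cases Int_def)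
  also have "\<dots> = (\<Sum>e\<in>H. \<Sum>v\<in>V. if v \<in> e then 1 else 0)" by (rule sum.swap)
  also have "\<dots> = (\<Sum>e\<in>H. 2)"
    using assms finV by (intro sum.cong) (auto simp: simple_graph_def sum.If_cases Int_absorb1)
  finally show ?thesis by simp
qed

text \<open>By the handshake identity twice the potential is a sum over the vertices of a quadratic
  in the degree, bounded by completing the square. As changes gain at least 1, this limits their
  number.\<close>

lemma potential_le:
  assumes "simple_graph V H"
  shows "potential V D H \<le> int (card V * D ^ 4)"
proof -
  have "2 * potential V D H = (\<Sum>v\<in>V. (2 * int D ^ 2 - int D) * int (degree H v) - 2 * int (degree H v) ^ 2)"
  proof -
    have "(\<Sum>v\<in>V. int (degree H v)) = 2 * int (card H)"
      using arg_cong[OF sum_degree[OF assms], of int] by simp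
    then show ?thesis
      by (simp add: potential_def sum_subtractf flip: sum_distrib_left)
  qed
  also have "\<dots> \<le> (\<Sum>v\<in>V. 2 * int D ^ 4)"
  proof (rule sum_mono)
    fix v
    let ?d = "int (degree H v)"
    have "0 \<le> (int D ^ 2 - ?d)\<^sup>2 + int D ^ 4 + int D * ?d + ?d\<^sup>2" by simp
    moreover have "(int D ^ 2 - ?d)\<^sup>2 = int D ^ 4 - 2 * int D ^ 2 * ?d + ?d\<^sup>2"
      by (simp add: power2_diff power_even_eq[symmetric] flip: power_mult)
    ultimately show "(2 * int D ^ 2 - int D) * ?d - 2 * ?d ^ 2 \<le> 2 * int D ^ 4"
      by (simp add: left_diff_distrib)
  qed
  finally show ?thesis by simp
qed

lemma card_le_if_stable:
  assumes G: "simple_graph V H" and st: "stable V D H" and "D \<ge> 1"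
  shows "card H \<le> card V * D\<^sup>2"
proof -
  have "degree H v \<le> D\<^sup>2" for v
  proof (cases "\<exists>e\<in>H. v \<in> e")
    case True
    then obtain e where e: "e \<in> H" "v \<in> e" by blast
    then have "finite e" using G by (metis card.infinite simple_graph_def zero_neq_numeral)
    then have "degree H v \<le> edge_degree H e"
      unfolding edge_degree_def using e by (intro member_le_sum) auto
    then show ?thesis using edge_degree_le_if_stable[OF G st e(1)] \<open>D \<ge> 1\<close> by linarith
  next
    case False
    then have "{e \<in> H. v \<in> e} = {}" by blast
    then show ?thesis unfolding degree_def by (simp only: card.empty)
  qed
  then have "(\<Sum>v\<in>V. degree H v) \<le> card V * D\<^sup>2" using sum_bounded_above[of V "degree H" "D\<^sup>2"] by simp
  then show ?thesis using sum_degree[OF G] by linarith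
qed

lemma improve_properties:
  assumes "finite H"
  shows "improve V D H e \<subseteq> insert e H"
    and "potential V D (insert e H) \<le> potential V D (improve V D H e)"
    and "stable V D (improve V D H e)"
proof -
  have "finite (Pow (insert e H))" "Pow (insert e H) \<noteq> {}" using assms by auto
  then obtain M where M: "M \<in> Pow (insert e H)"
    "\<And>H'. H' \<in> Pow (insert e H) \<Longrightarrow> potential V D H' \<le> potential V D M"
    by (rule finite_has_argmax[where f = "potential V D"]) blast
  have "is_arg_max (potential V D) (\<lambda>H'. H' \<subseteq> insert e H) (improve V D H e)"
    unfolding improve_def arg_max_def
    by (rule someI[of _ M]) (use M in \<open>auto simp: is_arg_max_linorder\<close>)
  then have *: "improve V D H e \<subseteq> insert e H"
    "\<And>H'. H' \<subseteq> insert e H \<Longrightarrow> potential V D H' \<le> potential V D (improve V D H e)"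
    by (auto simp: is_arg_max_linorder)
  show "improve V D H e \<subseteq> insert e H" by fact
  show "potential V D (insert e H) \<le> potential V D (improve V D H e)" by (rule *(2)) simp
  show "stable V D (improve V D H e)" unfolding stable_def using *(1) by (intro ballI *(2)) auto
qed

section \<open>A single run with fixed \<open>\<alpha>\<close> and \<open>\<gamma>\<close>\<close>

type_synonym 'a slot = "'a set set \<times> nat \<times> 'a set set"

text \<open>
  A slot \<open>(H, q, U)\<close> edits \<open>H\<close> until the last \<open>q = \<alpha>\<close> edges have not been improving. From then on
  \<open>H\<close> is frozen, and improving edges go to \<open>U\<close>, which is capped at \<open>\<gamma>\<close> edges.
\<close>

fun slot_step :: "'a set \<Rightarrow> nat \<Rightarrow> nat \<Rightarrow> nat \<Rightarrow> 'a slot \<Rightarrow> 'a set \<Rightarrow> 'a slot" where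
  "slot_step V D \<alpha> \<gamma> (H, q, U) e =
     (if \<alpha> \<le> q then (H, q, if improving V D H e \<and> card U < \<gamma> then insert e U else U)
      else if improving V D H e then (improve V D H e, 0, U)
      else (H, Suc q, U))"

definition slot_run :: "'a set \<Rightarrow> nat \<Rightarrow> nat \<Rightarrow> nat \<Rightarrow> 'a set list \<Rightarrow> 'a slot" where
  "slot_run V D \<alpha> \<gamma> es = foldl (slot_step V D \<alpha> \<gamma>) ({}, 0, {}) es"

lemma slot_run_Nil: "slot_run V D \<alpha> \<gamma> [] = ({}, 0, {})"
  by (simp add: slot_run_def)

lemma slot_run_snoc: "slot_run V D \<alpha> \<gamma> (es @ [e]) = slot_step V D \<alpha> \<gamma> (slot_run V D \<alpha> \<gamma> es) e"
  by (simp add: slot_run_def)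

lemma slot_run_bounds:
  assumes "slot_run V D \<alpha> \<gamma> es = (H, q, U)"
  shows "H \<subseteq> set es" "U \<subseteq> set es" "stable V D H" "card U \<le> \<gamma>" "q \<le> length es" "q \<le> \<alpha>"
proof -
  have "H \<subseteq> set es \<and> U \<subseteq> set es \<and> stable V D H \<and> card U \<le> \<gamma> \<and> q \<le> length es \<and> q \<le> \<alpha>"
    using assms
  proof (induction es arbitrary: H q U rule: rev_induct)
    case Nil
    then show ?case by (auto simp: slot_run_Nil stable_def)
  next
    case (snoc e es)
    obtain H0 q0 U0 where s: "slot_run V D \<alpha> \<gamma> es = (H0, q0, U0)" by (metis prod_cases3)
    note IH = snoc.IH[OF s]
    have finH: "finite H0" and finU: "finite U0" using IH by (auto intro: finite_subset)
    have step: "slot_step V D \<alpha> \<gamma> (H0, q0, U0) e = (H, q, U)" using snoc.prems s by (simp add: slot_run_snoc)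
    show ?case
    proof (cases "\<alpha> \<le> q0")
      case True
      then show ?thesis using step IH finU
        by (auto split: if_splits simp: card_insert_if)
    next
      case False
      show ?thesis
      proof (cases "improving V D H0 e")
        case True
        then have "H = improve V D H0 e" "q = 0" "U = U0" using step False by auto
        then show ?thesis using improve_properties[OF finH, of V D e] IH by auto
      next
        case not_imp: False
        then have "H = H0" "q = Suc q0" "U = U0" using step False by auto
        then show ?thesis using IH False by auto
      qed
    qed
  qed
  then show "H \<subseteq> set es" "U \<subseteq> set es" "stable V D H" "card U \<le> \<gamma>" "q \<le> length es" "q \<le> \<alpha>" by auto
qed

text \<open>Here \<open>p\<close> is the time of the last change of \<open>H\<close>.\<close>

lemma slot_run_trace:
  assumes "slot_run V D \<alpha> \<gamma> es = (H, q, U)"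
  shows "\<exists>p. p + q \<le> length es \<and> int p \<le> potential V D H * int \<alpha> \<and> fst (slot_run V D \<alpha> \<gamma> (take p es)) = H \<and>
    (\<forall>e\<in>set (take q (drop p es)). \<not> improving V D H e) \<and>
    (q < \<alpha> \<longrightarrow> p + q = length es) \<and>
    U \<subseteq> {e \<in> set (drop (p + q) es). improving V D H e} \<and>
    (card {e \<in> set (drop (p + q) es). improving V D H e} \<le> \<gamma> \<longrightarrow>
       {e \<in> set (drop (p + q) es). improving V D H e} \<subseteq> U)"
  using assms
proof (induction es arbitrary: H q U rule: rev_induct)
  case Nil
  then show ?case by (auto simp: slot_run_Nil potential_def degree_def)
next
  case (snoc e es)
  obtain H0 q0 U0 where s: "slot_run V D \<alpha> \<gamma> es = (H0, q0, U0)" by (metis prod_cases3)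
  note b = slot_run_bounds[OF s]
  have finH: "finite H0" using b by (auto intro: finite_subset)
  have step: "slot_step V D \<alpha> \<gamma> (H0, q0, U0) e = (H, q, U)" using snoc.prems s by (simp add: slot_run_snoc)
  obtain p where p: "p + q0 \<le> length es" "int p \<le> potential V D H0 * int \<alpha>"
    "fst (slot_run V D \<alpha> \<gamma> (take p es)) = H0"
    "\<forall>e\<in>set (take q0 (drop p es)). \<not> improving V D H0 e"
    "q0 < \<alpha> \<Longrightarrow> p + q0 = length es"
    "U0 \<subseteq> {e \<in> set (drop (p + q0) es). improving V D H0 e}"
    "card {e \<in> set (drop (p + q0) es). improving V D H0 e} \<le> \<gamma> \<Longrightarrow>
       {e \<in> set (drop (p + q0) es). improving V D H0 e} \<subseteq> U0"
    using snoc.IH[OF s] by blast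
  show ?case
  proof (cases "\<alpha> \<le> q0")
    case True
    then have eq: "H = H0" "q = q0" "U = (if improving V D H0 e \<and> card U0 < \<gamma> then insert e U0 else U0)"
      using step by auto
    define W where "W = {e \<in> set (drop (p + q0) es). improving V D H0 e}"
    have W': "{f \<in> set (drop (p + q) (es @ [e])). improving V D H f} = (if improving V D H0 e then insert e W else W)"
      using p(1) by (auto simp: W_def eq)
    have finW: "finite W" by (simp add: W_def)
    have "U \<subseteq> (if improving V D H0 e then insert e W else W)"
      using p(6) by (auto simp: eq W_def)
    moreover have "(if improving V D H0 e then insert e W else W) \<subseteq> U"
      if c: "card (if improving V D H0 e then insert e W else W) \<le> \<gamma>"
    proof (cases "improving V D H0 e")
      case imp: True
      \<comment> \<open>As long as all improving edges since the freeze fit under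
        \<open>\<gamma>\<close>, none has been refused, so \<open>U0\<close> is all of
        \<open>W\<close>.\<close>
      have "card W \<le> card (insert e W)" using finW by (intro card_mono) auto
      then have U0: "U0 = W" using p(6,7) c imp unfolding W_def by fastforce
      show ?thesis
      proof (cases "e \<in> W")
        case True
        then show ?thesis using U0 imp by (auto simp: eq)
      next
        case False
        then have "card U0 < \<gamma>" using c imp U0 finW by simp
        then show ?thesis using U0 imp by (auto simp: eq)
      qed
    next
      case False
      then show ?thesis using c p(7) by (simp add: eq W_def)
    qed
    ultimately have R: "U \<subseteq> {f \<in> set (drop (p + q) (es @ [e])). improving V D H f}"
      "card {f \<in> set (drop (p + q) (es @ [e])). improving V D H f} \<le> \<gamma> \<Longrightarrow>
        {f \<in> set (drop (p + q) (es @ [e])). improving V D H f} \<subseteq> U"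
      unfolding W' by simp_all
    show ?thesis
    proof (intro exI[of _ p] conjI impI)
      show "\<forall>f\<in>set (take q (drop p (es @ [e]))). \<not> improving V D H f"
        using p(1,4) by (simp add: eq(1,2))
    qed (use p(1-3) True R in \<open>simp_all add: eq(1,2)\<close>)
  next
    case False
    then have len: "p + q0 = length es" using p(5) by simp
    then have U0: "U0 = {}" using p(6) by simp
    show ?thesis
    proof (cases "improving V D H0 e")
      case True
      then have eq: "H = improve V D H0 e" "q = 0" "U = {}" using step False U0 by auto
      \<comment> \<open>The potential is an integer, so a change gains at least 1. Fewer than
        \<open>\<alpha>\<close> idle edges preceded it, so
        \<open>length es + 1 \<le> p + \<alpha>\<close>.\<close>
      have "potential V D H0 + 1 \<le> potential V D H"
        using True improve_properties(2)[OF finH, of V D e] by (simp add: eq improving_def)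
      then have "(potential V D H0 + 1) * int \<alpha> \<le> potential V D H * int \<alpha>" by (intro mult_right_mono) auto
      then have "int (length (es @ [e])) \<le> potential V D H * int \<alpha>"
        using p(2) len False by (simp add: algebra_simps)
      then show ?thesis using snoc.prems
        by (intro exI[of _ "length (es @ [e])"]) (simp add: eq(2,3))
    next
      case not_imp: False
      then have eq: "H = H0" "q = Suc q0" "U = {}" using step False U0 by auto
      have "take (Suc q0) (drop p (es @ [e])) = take q0 (drop p es) @ [e]"
        using len by simp
      then show ?thesis using p(1-4) len not_imp
        by (intro exI[of _ p]) (simp add: eq)
    qed
  qed
qed

section \<open>Analysis of a slot\<close>

text \<open>The freezing position depends on the edges that follow it. Fixing \<open>p\<close> and
  reading \<open>H\<close> off the prefix alone leaves the rest of the order random; a union bound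
  then runs over all positions.\<close>

definition slot_bad :: "'a set \<Rightarrow> nat \<Rightarrow> nat \<Rightarrow> nat \<Rightarrow> nat \<Rightarrow> 'a set list \<Rightarrow> nat \<Rightarrow> bool" where
  "slot_bad V D \<alpha> \<gamma> s es p \<longleftrightarrow>
     (let H = fst (slot_run V D \<alpha> \<gamma> (drop s (take p es)))
      in \<gamma> < card {e \<in> set (drop p es). improving V D H e} \<and>
         (\<forall>e\<in>set (take \<alpha> (drop p es)). \<not> improving V D H e))"

text \<open>Given the prefix, \<open>H\<close> and the set of remaining improving edges are fixed.
  If there are more than \<open>\<gamma>\<close> of them, \<open>\<alpha>\<close> draws rarely miss
  them all.\<close>

lemma prob_slot_bad:
  assumes "finite E" "p \<le> card E"
  shows "measure_pmf.prob (random_order E) {es. slot_bad V D \<alpha> \<gamma> s es p}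
           \<le> exp (- (real \<alpha> * real \<gamma> / real (card E)))"
proof -
  define Q where "Q xs zs \<longleftrightarrow>
     (let H = fst (slot_run V D \<alpha> \<gamma> (drop s xs))
      in \<gamma> < card {e \<in> set zs. improving V D H e} \<and> (\<forall>e\<in>set (take \<alpha> zs). \<not> improving V D H e))" for xs zs
  have "measure_pmf.prob (random_order E) {es. Q (take p es) (drop p es)} \<le> exp (- (real \<alpha> * real \<gamma> / real (card E)))"
  proof (rule prob_random_order_prefix[OF assms])
    fix xs assume xs: "distinct xs" "set xs \<subseteq> E" "length xs = p"
    define H where "H = fst (slot_run V D \<alpha> \<gamma> (drop s xs))"
    define B where "B = {e \<in> E - set xs. improving V D H e}"
    show "measure_pmf.prob (random_order (E - set xs)) {ys. Q xs ys} \<le> exp (- (real \<alpha> * real \<gamma> / real (card E)))"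
    proof (cases "\<gamma> < card B")
      case True
      have "measure_pmf.prob (random_order (E - set xs)) {ys. Q xs ys}
          \<le> measure_pmf.prob (random_order (E - set xs)) {ys. set (take \<alpha> ys) \<inter> B = {}}"
        using assms by (intro prob_random_order_mono) (auto simp: Q_def B_def H_def Let_def)
      also have "\<dots> \<le> exp (- (real \<alpha> * real (card B) / real (card E)))"
        using assms by (intro prob_random_order_avoid) (auto simp: B_def intro: card_mono)
      also have "\<dots> \<le> exp (- (real \<alpha> * real \<gamma> / real (card E)))"
        using True by (auto intro!: divide_right_mono mult_left_mono)
      finally show ?thesis .
    next
      case False
      have "measure_pmf.prob (random_order (E - set xs)) {ys. Q xs ys}
          \<le> measure_pmf.prob (random_order (E - set xs)) {ys. False}"
        using assms False by (intro prob_random_order_mono) (auto simp: Q_def B_def H_def Let_def)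
      then show ?thesis by (simp add: order_trans[OF _ exp_ge_zero])
    qed
  qed
  then show ?thesis by (simp add: Q_def slot_bad_def)
qed

text \<open>The deterministic part. The last change comes at most
  \<open>card V * D ^ 4 * \<alpha>\<close> edges after \<open>s\<close>, and \<open>\<alpha>\<close>
  idle edges later the slot is frozen. As no position is bad, the improving edges after that fit
  into \<open>U\<close>, so every edge of the suffix is in \<open>H \<union> U\<close> or has a
  large degree sum in \<open>H\<close>.\<close>

lemma matching_number_frozen_slot:
  assumes G: "simple_graph V (set es)" and D: "D \<ge> 12"
    and len: "s + (card V * D ^ 4 + 1) * \<alpha> \<le> length es"
    and good: "\<And>p. p \<le> length es \<Longrightarrow> \<not> slot_bad V D \<alpha> \<gamma> s es p"
    and run: "slot_run V D \<alpha> \<gamma> (drop s es) = (H, q, U)"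
  shows "(1 - 1 / real D) * real (matching_number (set (drop (s + (card V * D ^ 4 + 1) * \<alpha>) es)))
           \<le> (3/2 + 6 / real D) * real (matching_number (H \<union> U))"
proof -
  let ?N = "card V * D ^ 4" and ?ys = "drop s es"
  note b = slot_run_bounds[OF run]
  have sub: "set ?ys \<subseteq> set es" by (rule set_drop_subset)
  have HU: "H \<subseteq> set es" "U \<subseteq> set es" using b sub by auto
  obtain p where p: "p + q \<le> length ?ys" "int p \<le> potential V D H * int \<alpha>"
    "fst (slot_run V D \<alpha> \<gamma> (take p ?ys)) = H"
    "\<forall>e\<in>set (take q (drop p ?ys)). \<not> improving V D H e"
    "q < \<alpha> \<Longrightarrow> p + q = length ?ys"
    "card {e \<in> set (drop (p + q) ?ys). improving V D H e} \<le> \<gamma> \<Longrightarrow>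
       {e \<in> set (drop (p + q) ?ys). improving V D H e} \<subseteq> U"
    using slot_run_trace[OF run] by blast
  have "potential V D H * int \<alpha> \<le> int ?N * int \<alpha>"
    using potential_le[OF simple_graph_subset[OF G HU(1)], of D] by (intro mult_right_mono) auto
  then have "int p \<le> int (?N * \<alpha>)" using p(2) by simp
  then have pN: "p \<le> ?N * \<alpha>" by (simp only: of_nat_le_iff)
  have q: "q = \<alpha>"
  proof (rule ccontr)
    assume "q \<noteq> \<alpha>"
    then have "q < \<alpha>" using b by simp
    then have "p + q = length ?ys" by (rule p(5))
    then show False using len pN \<open>q < \<alpha>\<close> by (simp add: algebra_simps)
  qed
  \<comment> \<open>\<open>p\<close> counts from the start of the slot, positions in
    \<open>slot_bad\<close> from the start of the stream.\<close>
  have "\<not> slot_bad V D \<alpha> \<gamma> s es (s + p)" using p(1) len by (intro good) auto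
  moreover have "drop s (take (s + p) es) = take p ?ys" by (simp add: drop_take)
  moreover have "drop (s + p) es = drop p ?ys" by (simp add: add.commute)
  ultimately have few: "card {e \<in> set (drop p ?ys). improving V D H e} \<le> \<gamma>"
    using p(3,4) q by (auto simp: slot_bad_def Let_def)
  have "card {e \<in> set (drop (p + q) ?ys). improving V D H e} \<le> card {e \<in> set (drop p ?ys). improving V D H e}"
    using set_drop_subset_set_drop[of p "p + q" ?ys] by (intro card_mono) auto
  then have collected: "{e \<in> set (drop (p + q) ?ys). improving V D H e} \<subseteq> U"
    using p(6) few by linarith
  define E' where "E' = set (drop (s + (?N + 1) * \<alpha>) es)"
  have "E' \<subseteq> set (drop (s + (p + q)) es)"
    unfolding E'_def using pN q by (intro set_drop_subset_set_drop) (simp add: algebra_simps)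
  then have E': "E' \<subseteq> set (drop (p + q) ?ys)" by (simp add: add.commute add.left_commute)
  have GH: "simple_graph V H" using simple_graph_subset[OF G HU(1)] .
  show ?thesis unfolding E'_def[symmetric]
  proof (rule edcs_matching_number[where V = V and H = H])
    show "simple_graph V E'" unfolding E'_def by (rule simple_graph_subset[OF G set_drop_subset])
    show "simple_graph V (H \<union> U)" using HU by (intro simple_graph_subset[OF G]) auto
    show "edge_degree H e \<le> D\<^sup>2" if "e \<in> H" for e
      using edge_degree_le_if_stable[OF GH b(3) that] D by simp
    show "D\<^sup>2 \<le> edge_degree H e + D" if e: "e \<in> E' - (H \<union> U)" for e
    proof (rule edge_degree_ge_if_not_improving)
      have "e \<in> set es" using e unfolding E'_def by (auto dest: in_set_dropD)
      then show "simple_graph V (insert e H)" using HU by (intro simple_graph_subset[OF G]) auto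
      show "\<not> improving V D H e" using e E' collected by auto
    qed (use e D in auto)
  qed (use D in auto)
qed

lemma matching_number_suffix:
  assumes "finite (set es)" "matching (set es) M"
  shows "card M \<le> matching_number (set (drop k es)) + card (M \<inter> set (take k es))"
proof -
  have finM: "finite M" using assms by (auto simp: matching_def intro: finite_subset)
  have "set es = set (take k es) \<union> set (drop k es)" by (metis append_take_drop_id set_append)
  then have "M - set (take k es) \<subseteq> set (drop k es)" using assms by (auto simp: matching_def)
  then have "matching (set (drop k es)) (M - set (take k es))"
    by (rule matching_mono[OF matching_subset[OF assms(2) Diff_subset]])
  then have "card (M - set (take k es)) \<le> matching_number (set (drop k es))"
    by (intro card_le_matching_number) auto
  moreover have "card M = card (M - set (take k es)) + card (M \<inter> set (take k es))"
    using card_Int_Diff[OF finM, of "set (take k es)"] by linarith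
  ultimately show ?thesis by linarith
qed

text \<open>\<open>a\<close> is a threshold for the edges of a fixed maximum matching lost among the
  first \<open>k\<close> edges. The two summands are the two failures: a bad position among
  \<open>card E + 1\<close> many, or at least \<open>a\<close> lost edges.\<close>

lemma prob_slot_matching:
  assumes G: "simple_graph V E" and D: "D \<ge> 12" and "a > 0"
    and k: "s + (card V * D ^ 4 + 1) * \<alpha> = k" "k \<le> card E"
  shows "measure_pmf.prob (random_order E)
           {es. \<not> (case slot_run V D \<alpha> \<gamma> (drop s es) of (H, q, U) \<Rightarrow>
              (1 - 1 / real D) * (real (matching_number E) - real a)
                \<le> (3/2 + 6 / real D) * real (matching_number (H \<union> U)))}
         \<le> real (card E + 1) * exp (- (real \<alpha> * real \<gamma> / real (card E)))
           + (3 * real (matching_number E) * real k / (real a * real (card E))) ^ a"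
proof -
  have finE: "finite E" using G by (rule simple_graph_finite)
  obtain M where M: "matching E M" "card M = matching_number E"
    using maximum_matching_exists finE by blast
  have ME: "M \<subseteq> E" using M by (simp add: matching_def)
  let ?P = "measure_pmf.prob (random_order E)"
  let ?B = "\<Union>p\<in>{..card E}. {es. slot_bad V D \<alpha> \<gamma> s es p}"
  let ?A = "{es. a \<le> card (M \<inter> set (take k es))}"
  have "?P {es. \<not> (case slot_run V D \<alpha> \<gamma> (drop s es) of (H, q, U) \<Rightarrow>
              (1 - 1 / real D) * (real (matching_number E) - real a)
                \<le> (3/2 + 6 / real D) * real (matching_number (H \<union> U)))}
      \<le> ?P {es. es \<in> ?B \<union> ?A}"
  proof (rule prob_random_order_mono[OF finE], rule ccontr)
    fix es assume es: "distinct es" "set es = E"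
      and fail: "\<not> (case slot_run V D \<alpha> \<gamma> (drop s es) of (H, q, U) \<Rightarrow>
              (1 - 1 / real D) * (real (matching_number E) - real a)
                \<le> (3/2 + 6 / real D) * real (matching_number (H \<union> U)))"
      and "es \<notin> ?B \<union> ?A"
    then have good: "\<And>p. p \<le> card E \<Longrightarrow> \<not> slot_bad V D \<alpha> \<gamma> s es p"
      and few: "card (M \<inter> set (take k es)) < a" by auto
    have len: "length es = card E" using es by (metis distinct_card)
    obtain H q U where run: "slot_run V D \<alpha> \<gamma> (drop s es) = (H, q, U)" by (metis prod_cases3)
    have "real (matching_number E) - real a \<le> real (matching_number (set (drop k es)))"
      using matching_number_suffix[of es M k] M es few finE by simp
    then have "(1 - 1 / real D) * (real (matching_number E) - real a)
        \<le> (1 - 1 / real D) * real (matching_number (set (drop k es)))"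
      using D by (intro mult_left_mono) auto
    also have "\<dots> \<le> (3/2 + 6 / real D) * real (matching_number (H \<union> U))"
      using matching_number_frozen_slot[OF _ D _ _ run] G es good len k by simp
    finally show False using fail run by simp
  qed
  also have "{es. es \<in> ?B \<union> ?A} = ?B \<union> ?A" by blast
  also have "?P (?B \<union> ?A) \<le> ?P ?B + ?P ?A"
    by (rule measure_Un_le) auto
  also have "?P ?B \<le> (\<Sum>p\<in>{..card E}. ?P {es. slot_bad V D \<alpha> \<gamma> s es p})"
    by (intro measure_pmf.finite_measure_subadditive_finite) auto
  also have "\<dots> \<le> (\<Sum>p\<in>{..card E}. exp (- (real \<alpha> * real \<gamma> / real (card E))))"
    using prob_slot_bad[OF finE] by (intro sum_mono) auto
  also have "\<dots> = real (card E + 1) * exp (- (real \<alpha> * real \<gamma> / real (card E)))" by simp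
  also have "?P ?A \<le> (3 * real (card M) * real k / (real a * real (card E))) ^ a"
    using k \<open>a > 0\<close> by (intro prob_random_order_prefix_hits finE ME)
  finally show ?thesis using M(2) by simp
qed

text \<open>The endpoints of a maximum matching are a vertex cover with
  \<open>2 * matching_number E\<close> vertices. So a long stream forces a large matching number,
  which the tail bound needs.\<close>

lemma card_le_matching_number_times_vertices:
  assumes G: "simple_graph V E"
  shows "card E \<le> 2 * matching_number E * card V"
proof -
  have finE: "finite E" and finV: "finite V" using G simple_graph_finite by (auto simp: simple_graph_def)
  obtain M where M: "matching E M" "card M = matching_number E"
    using maximum_matching_exists finE by blast
  have finM: "finite M" using M finE by (auto simp: matching_def intro: finite_subset)
  have MV: "\<Union>M \<subseteq> V" using Union_matching_subset[OF G M(1)] .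
  have "E \<subseteq> (\<lambda>(u, v). {u, v}) ` (\<Union>M \<times> V)"
  proof
    fix e assume e: "e \<in> E"
    have "e \<inter> \<Union>M \<noteq> {}"
    proof
      assume *: "e \<inter> \<Union>M = {}"
      then have "matching E (insert e M)" using M e by (intro matching_insert)
      then have "card (insert e M) \<le> card M" using card_le_matching_number[OF finE] M by metis
      then have "e \<in> M" using finM by (metis card_insert_disjoint lessI not_le)
      then have "e = {}" using * by blast
      then show False using e G by (auto simp: simple_graph_def)
    qed
    then obtain u where u: "u \<in> e" "u \<in> \<Union>M" by blast
    obtain v where "e = {u, v}" "v \<in> V" by (rule simple_graph_edgeE[OF G e u(1)])
    then show "e \<in> (\<lambda>(u, v). {u, v}) ` (\<Union>M \<times> V)" using u by auto
  qed
  then have "card E \<le> card (\<Union>M \<times> V)"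
    using finV MV by (intro surj_card_le) (auto intro: finite_subset)
  then show ?thesis using card_Union_matching[OF G M(1)] M(2) by (simp add: card_cartesian_product)
qed

section \<open>The streaming algorithm\<close>

text \<open>
  Only the memory content has to determine the continuation, so the update may be computed from any
  stream that leads to the same content.
\<close>

lemma streaming_alg_exists:
  fixes F :: "'a set list \<Rightarrow> 'x set" and out :: "'a set list \<Rightarrow> 'o"
  assumes step: "\<And>xs ys e. F xs = F ys \<Longrightarrow> F (xs @ [e]) = F (ys @ [e])"
    and out: "\<And>xs ys. F xs = F ys \<Longrightarrow> out xs = out ys"
    and X: "finite X" "card X \<le> 2 ^ w"
    and F: "\<And>es. distinct es \<Longrightarrow> simple_graph V (set es) \<Longrightarrow> F es \<subseteq> X \<and> real (card (F es)) \<le> b"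
  shows "\<exists>A. uses_space V A w b \<and> (\<forall>es. distinct es \<and> simple_graph V (set es) \<longrightarrow> output_on A es = out es)"
proof -
  obtain code :: "'x \<Rightarrow> nat" where code: "code ` X = {i. i < card X}" "inj_on code X"
    using finite_imp_inj_to_nat_seg[OF X(1)] by (metis card_Collect_less_nat card_image)
  define valid where "valid es \<longleftrightarrow> distinct es \<and> simple_graph V (set es)" for es :: "'a set list"
  \<comment> \<open>Sorting makes the list of words a function of the set \<open>F es\<close>
    alone.\<close>
  define mem where "mem es = sorted_list_of_set (code ` F es)" for es
  define rep where "rep l = (SOME es. valid es \<and> mem es = l)" for l
  define A where "A = \<lparr>init_mem = mem [], update_mem = (\<lambda>l e. mem (rep l @ [e])), result = (\<lambda>l. out (rep l))\<rparr>"
  have FX: "F es \<subseteq> X" "finite (F es)" if "valid es" for es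
    using F that X(1) by (auto simp: valid_def intro: finite_subset)
  have rep: "F (rep (mem es)) = F es" if "valid es" for es
  proof -
    define r where "r = rep (mem es)"
    have r: "valid r \<and> mem r = mem es"
      unfolding r_def rep_def by (rule someI[of _ es]) (use that in simp)
    then have "set (mem r) = set (mem es)" by simp
    then have "code ` F r = code ` F es" using r that FX by (simp add: mem_def)
    then have "F r = F es" using inj_on_image_eq_iff[OF code(2)] FX r that by metis
    then show ?thesis by (simp add: r_def)
  qed
  have mem: "memory_after A es = mem es" if "valid es" for es
    using that
  proof (induction es rule: rev_induct)
    case Nil
    then show ?case by (simp add: memory_after_def A_def)
  next
    case (snoc e es)
    have "valid es" using snoc.prems simple_graph_subset by (fastforce simp: valid_def)
    then have "memory_after A es = mem es" by (rule snoc.IH)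
    then have "memory_after A (es @ [e]) = mem (rep (mem es) @ [e])"
      by (simp add: memory_after_def A_def)
    then show ?case using step[OF rep[OF \<open>valid es\<close>]] by (simp add: mem_def)
  qed
  show ?thesis
  proof (intro exI[of _ A] conjI allI impI)
    show "uses_space V A w b" unfolding uses_space_def
    proof (intro allI impI)
      fix es :: "'a set list" assume "distinct es \<and> simple_graph V (set es)"
      then have v: "valid es" by (simp add: valid_def)
      have "length (mem es) = card (code ` F es)" by (simp add: mem_def)
      also have "\<dots> = card (F es)" using FX[OF v] code(2) by (intro card_image) (rule inj_on_subset)
      finally have "real (length (mem es)) \<le> b" using F v by (simp add: valid_def)
      moreover have "x < 2 ^ w" if "x \<in> set (mem es)" for x
      proof -
        have "x \<in> code ` X" using that FX[OF v] by (auto simp: mem_def)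
        then show ?thesis using code(1) X(2) by simp
      qed
      ultimately show "real (length (memory_after A es)) \<le> b \<and> (\<forall>x\<in>set (memory_after A es). x < 2 ^ w)"
        by (simp add: mem[OF v])
    qed
    fix es assume "distinct es \<and> simple_graph V (set es)"
    then have v: "valid es" by (simp add: valid_def)
    have "output_on A es = out (rep (mem es))"
      by (simp add: output_on_def mem[OF v]) (simp add: A_def)
    then show "output_on A es = out es" using out[OF rep[OF v]] by simp
  qed
qed

section \<open>Schedule of the slots and layout of the memory\<close>

datatype 'e item = Num nat nat | Edge nat 'e

lemma card_edges_le:
  assumes "finite V"
  shows "card {e. e \<subseteq> V \<and> card e = 2} \<le> card V ^ 2"
  using n_subsets[OF assms, of 2] binomial_fact_pow[of "card V" 2]
  by (metis fact_ge_1 mult.right_neutral mult_le_mono2 order_trans)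

text \<open>\<open>R\<close> is the ratio of consecutive slot starts, and \<open>L\<close> carries
  the factor \<open>log n\<close> for the confidence. In the end \<open>D\<close>, \<open>R\<close>
  and \<open>L\<close> are \<open>12 / \<epsilon>\<close>, \<open>48 / \<epsilon>\<close> and
  \<open>(c + 4) * log 2 n\<close>, rounded up.\<close>

locale slot_schedule =
  fixes V :: "'a set" and D R L :: nat
  assumes finV: "finite V" and R: "R \<ge> 2" and L: "L \<ge> 1" and D: "D \<ge> 1"
begin

definition budget :: nat where "budget = card V * D ^ 4 + 1"

definition \<alpha> :: "nat \<Rightarrow> nat" where "\<alpha> j = L * R ^ j"

text \<open>A slot freezes within \<open>budget * \<alpha> j\<close> edges. Starting it only after
  equally many costs a factor 2, as it is frozen by time \<open>2 * start j\<close>, and keeps the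
  number of simultaneous slots small.\<close>

definition start :: "nat \<Rightarrow> nat" where "start j = budget * \<alpha> j"

text \<open>Chosen so that \<open>\<alpha> j * cap = start (j + 2) * L\<close>: in a stream shorter
  than \<open>start (j + 2)\<close> a given position is then bad with probability at most
  \<open>exp (- L)\<close>.\<close>

definition cap :: nat where "cap = budget * R\<^sup>2 * L"

text \<open>
  Slot \<open>j\<close> reads the stream from time \<open>start j\<close> on, and its result is used for streams whose length is
  at least \<open>start (j + 1)\<close> and below \<open>start (j + 2)\<close>. So at any time two slots have to be kept. Streams
  shorter than \<open>start 1\<close> are stored completely.
\<close>

definition slot :: "nat \<Rightarrow> 'a set list \<Rightarrow> 'a slot" where
  "slot j es = slot_run V D (\<alpha> j) cap (drop (start j) es)"

definition level :: "nat \<Rightarrow> nat" where "level t = (LEAST j. t < start (j + 2))"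

definition stored :: "'a set list \<Rightarrow> 'a set set" where
  "stored es = (if length es < start 1 then set es else {})"

text \<open>The memory is an unordered set, so every word carries a tag. Halving an edge tag gives
  back \<open>i\<close>, and 0 is left for \<open>stored\<close>.\<close>

fun slot_items :: "nat \<Rightarrow> 'a slot \<Rightarrow> 'a set item set" where
  "slot_items i (H, q, U) = insert (Num i q) (Edge (2 * i) ` H \<union> Edge (2 * i + 1) ` U)"

definition memory :: "'a set list \<Rightarrow> 'a set item set" where
  "memory es = insert (Num 0 (length es)) (Edge 0 ` stored es) \<union>
     slot_items 1 (slot (level (length es)) es) \<union> slot_items 2 (slot (level (length es) + 1) es)"

lemma budget_pos: "budget > 0" by (simp add: budget_def)

lemma start_Suc: "start (Suc j) = R * start j"
  by (simp add: start_def \<alpha>_def)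

lemma start_strict_mono: "strict_mono start"
  unfolding strict_mono_Suc_iff
proof
  fix j
  have "start j > 0" using L R budget_pos by (simp add: start_def \<alpha>_def)
  then show "start j < start (Suc j)" using R by (simp add: start_Suc)
qed

lemma less_start_level: "t < start (level t + 2)"
proof -
  have "t < start (t + 2)"
    using strict_mono_imp_increasing[OF start_strict_mono, of "t + 2"] by simp
  then show ?thesis unfolding level_def by (rule LeastI)
qed

lemma start_level_le:
  assumes "start 1 \<le> t"
  shows "start (level t + 1) \<le> t"
proof (cases "level t")
  case 0
  then show ?thesis using assms by simp
next
  case (Suc j)
  then have "\<not> t < start (j + 2)" using not_less_Least[of j "\<lambda>j. t < start (j + 2)"] by (simp add: level_def)
  then show ?thesis using Suc by simp
qed

text \<open>When the level rises, the second kept slot becomes the first, and the stated time shows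
  that the new second slot has not read anything yet.\<close>

lemma level_Suc:
  "level (Suc t) = level t \<or> level (Suc t) = level t + 1 \<and> Suc t = start (level t + 2)"
proof -
  have le: "level t \<le> level (Suc t)"
    unfolding level_def[of t] using less_start_level[of "Suc t"] by (intro Least_le) simp
  show ?thesis
  proof (cases "Suc t < start (level t + 2)")
    case True
    then have "level (Suc t) \<le> level t" unfolding level_def[of "Suc t"] by (rule Least_le)
    then show ?thesis using le by simp
  next
    case False
    then have eq: "Suc t = start (level t + 2)" using less_start_level[of t] by simp
    also have "\<dots> < start ((level t + 1) + 2)" using start_strict_mono by (simp add: strict_mono_less)
    finally have "level (Suc t) \<le> level t + 1" unfolding level_def[of "Suc t"] by (rule Least_le)
    moreover have "level (Suc t) \<noteq> level t" using less_start_level[of "Suc t"] eq by auto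
    ultimately show ?thesis using le eq by simp
  qed
qed

lemma slot_snoc_cong:
  assumes "length xs = length ys" "slot j xs = slot j ys"
  shows "slot j (xs @ [e]) = slot j (ys @ [e])"
proof (cases "start j \<le> length xs")
  case True
  then show ?thesis using assms by (simp add: slot_def slot_run_snoc)
next
  case False
  then show ?thesis using assms by (simp add: slot_def)
qed

lemma slot_eq_Nil: "length xs \<le> start j \<Longrightarrow> slot j xs = slot j []"
  by (simp add: slot_def)

lemma slot_items_inject: "slot_items i a = slot_items i b \<Longrightarrow> a = b"
proof -
  assume eq: "slot_items i a = slot_items i b"
  obtain H q U H' q' U' where ab: "a = (H, q, U)" "b = (H', q', U')" by (metis prod_cases3)
  have "q = q'"
  proof -
    have "Num i q \<in> slot_items i b" using eq[symmetric] ab by simp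
    then show ?thesis using ab by auto
  qed
  moreover have "e \<in> H \<longleftrightarrow> e \<in> H'" for e
  proof -
    have "e \<in> H \<longleftrightarrow> Edge (2 * i) e \<in> slot_items i a" using ab by auto
    also have "\<dots> \<longleftrightarrow> e \<in> H'" unfolding eq using ab by auto
    finally show ?thesis .
  qed
  moreover have "e \<in> U \<longleftrightarrow> e \<in> U'" for e
  proof -
    have "e \<in> U \<longleftrightarrow> Edge (2 * i + 1) e \<in> slot_items i a" using ab by auto
    also have "\<dots> \<longleftrightarrow> e \<in> U'" unfolding eq using ab by auto
    finally show ?thesis .
  qed
  ultimately show "a = b" using ab by auto
qed

fun tag :: "'e item \<Rightarrow> nat" where
  "tag (Num i x) = i"
| "tag (Edge i e) = i div 2"

lemma tag_slot_items: "x \<in> slot_items i a \<Longrightarrow> tag x = i"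
  by (cases a) auto

lemma memory_inject:
  assumes "memory xs = memory ys"
  shows "length xs = length ys" "stored xs = stored ys"
    "slot (level (length xs)) xs = slot (level (length ys)) ys"
    "slot (level (length xs) + 1) xs = slot (level (length ys) + 1) ys"
proof -
  have t: "{x \<in> memory es. tag x = 0} = insert (Num 0 (length es)) (Edge 0 ` stored es)"
    "{x \<in> memory es. tag x = 1} = slot_items 1 (slot (level (length es)) es)"
    "{x \<in> memory es. tag x = 2} = slot_items 2 (slot (level (length es) + 1) es)" for es
    by (auto simp: memory_def dest: tag_slot_items)
  have 0: "insert (Num 0 (length xs)) (Edge 0 ` stored xs) = insert (Num 0 (length ys)) (Edge 0 ` stored ys)"
    using t(1)[of xs] t(1)[of ys] assms by simp
  have "Num 0 (length xs) \<in> insert (Num 0 (length ys)) (Edge 0 ` stored ys)" unfolding 0[symmetric] by simp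
  then show "length xs = length ys" by auto
  have "e \<in> stored xs \<longleftrightarrow> e \<in> stored ys" for e
  proof -
    have "e \<in> stored xs \<longleftrightarrow> Edge 0 e \<in> insert (Num 0 (length xs)) (Edge 0 ` stored xs)" by auto
    also have "\<dots> \<longleftrightarrow> e \<in> stored ys" unfolding 0 by auto
    finally show ?thesis .
  qed
  then show "stored xs = stored ys" by blast
  show "slot (level (length xs)) xs = slot (level (length ys)) ys"
    using t(2)[of xs] t(2)[of ys] assms by (metis slot_items_inject)
  show "slot (level (length xs) + 1) xs = slot (level (length ys) + 1) ys"
    using t(3)[of xs] t(3)[of ys] assms by (metis slot_items_inject)
qed

lemma memory_snoc_cong:
  assumes "memory xs = memory ys"
  shows "memory (xs @ [e]) = memory (ys @ [e])"
proof -
  note eq = memory_inject[OF assms]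
  let ?j = "level (length ys)"
  have s: "slot ?j xs = slot ?j ys" "slot (?j + 1) xs = slot (?j + 1) ys" using eq by auto
  have "stored (xs @ [e]) = stored (ys @ [e])"
    using eq(1,2) by (auto simp: stored_def split: if_splits)
  moreover have "slot (level (Suc (length ys))) (xs @ [e]) = slot (level (Suc (length ys))) (ys @ [e])"
    using level_Suc[of "length ys"] slot_snoc_cong[OF eq(1)] s by auto
  moreover have "slot (level (Suc (length ys)) + 1) (xs @ [e]) = slot (level (Suc (length ys)) + 1) (ys @ [e])"
    using level_Suc[of "length ys"]
  proof (elim disjE conjE)
    assume "level (Suc (length ys)) = ?j"
    then show ?thesis using slot_snoc_cong[OF eq(1) s(2)] by simp
  next
    \<comment> \<open>The slot taken up now starts right after this edge, so it is in its initial
      state for both streams.\<close>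
    assume *: "level (Suc (length ys)) = ?j + 1" "Suc (length ys) = start (?j + 2)"
    then show ?thesis using slot_eq_Nil[of "xs @ [e]" "?j + 2"] slot_eq_Nil[of "ys @ [e]" "?j + 2"] eq(1)
      by simp
  qed
  ultimately show ?thesis using eq(1) by (simp add: memory_def)
qed

definition some_max_matching :: "'a set set \<Rightarrow> 'a set set" where
  "some_max_matching E = (SOME M. max_matching E M)"

lemma some_max_matching: "finite E \<Longrightarrow> max_matching E (some_max_matching E)"
  unfolding some_max_matching_def max_matching_def
  by (rule someI_ex) (metis maximum_matching_exists)

definition answer :: "'a set list \<Rightarrow> 'a set set" where
  "answer es = some_max_matching
     (if length es < start 1 then set es
      else case slot (level (length es)) es of (H, q, U) \<Rightarrow> H \<union> U)"

lemma answer_cong: "memory xs = memory ys \<Longrightarrow> answer xs = answer ys"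
  using memory_inject[of xs ys] by (auto simp: answer_def stored_def split: if_splits)

text \<open>Edge tags are 0 for \<open>stored\<close>, 2 and 3 for one slot, 4 and 5 for the other.
  Every number is at most the length of the stream, hence at most
  \<open>(card V)\<^sup>2\<close>.\<close>

definition universe :: "'a set item set" where
  "universe = (\<lambda>(i, x). Num i x) ` ({..2} \<times> {..(card V)\<^sup>2}) \<union>
     (\<lambda>(i, e). Edge i e) ` ({..5} \<times> {e. e \<subseteq> V \<and> card e = 2})"

lemma finite_edges: "finite {e. e \<subseteq> V \<and> card e = 2}"
  using finV by simp

lemma finite_universe: "finite universe"
  using finite_edges by (auto simp: universe_def)

lemma card_universe_le: "card universe \<le> 9 * (card V)\<^sup>2 + 3"
proof -
  have "card universe \<le> card ({..2::nat} \<times> {..(card V)\<^sup>2}) + card ({..5::nat} \<times> {e. e \<subseteq> V \<and> card e = 2})"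
    unfolding universe_def using finite_edges
    by (intro order_trans[OF card_Un_le] add_mono card_image_le) auto
  also have "\<dots> = 3 * ((card V)\<^sup>2 + 1) + 6 * card {e. e \<subseteq> V \<and> card e = 2}"
    by (simp add: card_cartesian_product)
  finally show ?thesis using card_edges_le[OF finV] by simp
qed

lemma slot_items_bounds:
  assumes G: "simple_graph V (set es)" and "i \<in> {1, 2}" "length es \<le> (card V)\<^sup>2"
  shows "slot_items i (slot j es) \<subseteq> universe" "card (slot_items i (slot j es)) \<le> 1 + card V * D\<^sup>2 + cap"
proof -
  obtain H q U where HqU: "slot j es = (H, q, U)" by (metis prod_cases3)
  note b = slot_run_bounds[OF HqU[unfolded slot_def]]
  have HU: "H \<subseteq> set es" "U \<subseteq> set es" using b set_drop_subset by fastforce+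
  then have "H \<subseteq> {e. e \<subseteq> V \<and> card e = 2}" "U \<subseteq> {e. e \<subseteq> V \<and> card e = 2}"
    using G by (auto simp: simple_graph_def)
  moreover have "q \<le> (card V)\<^sup>2" using b(5) assms(3) by simp
  ultimately show "slot_items i (slot j es) \<subseteq> universe"
    using assms(2) unfolding HqU by (fastforce simp: universe_def)
  have fin: "finite H" "finite U" using HU by (auto intro: finite_subset)
  have "card (slot_items i (slot j es)) \<le> Suc (card (Edge (2 * i) ` H \<union> Edge (2 * i + 1) ` U))"
    unfolding HqU slot_items.simps by (rule card_insert_le_m1) simp_all
  also have "card (Edge (2 * i) ` H \<union> Edge (2 * i + 1) ` U) \<le> card H + card U"
    using fin by (intro order_trans[OF card_Un_le] add_mono card_image_le)
  also have "card H \<le> card V * D\<^sup>2"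
    by (rule card_le_if_stable[OF simple_graph_subset[OF G HU(1)] b(3) D])
  also have "card U \<le> cap" by (rule b(4))
  finally show "card (slot_items i (slot j es)) \<le> 1 + card V * D\<^sup>2 + cap" by simp
qed

lemma memory_bounds:
  assumes "distinct es" and G: "simple_graph V (set es)"
  shows "memory es \<subseteq> universe" "card (memory es) \<le> 10 * cap"
proof -
  have "set es \<subseteq> {e. e \<subseteq> V \<and> card e = 2}" using G by (auto simp: simple_graph_def)
  then have "card (set es) \<le> card {e. e \<subseteq> V \<and> card e = 2}" using finite_edges by (intro card_mono)
  then have len: "length es \<le> (card V)\<^sup>2" using card_edges_le[OF finV] assms(1) by (simp add: distinct_card)
  have st: "stored es \<subseteq> {e. e \<subseteq> V \<and> card e = 2}"
    using G by (auto simp: stored_def simple_graph_def)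
  then have "insert (Num 0 (length es)) (Edge 0 ` stored es) \<subseteq> universe"
    using len by (fastforce simp: universe_def)
  then show "memory es \<subseteq> universe"
    using slot_items_bounds(1)[OF G _ len] unfolding memory_def by blast
  have "card (stored es) \<le> start 1"
    using assms(1) by (auto simp: stored_def distinct_card)
  moreover have "start 1 \<le> cap"
    unfolding start_def \<alpha>_def cap_def using R by (simp add: power2_eq_square)
  moreover have "card V * D\<^sup>2 \<le> cap"
  proof -
    have "D\<^sup>2 \<le> D ^ 4" using D by (intro power_increasing) auto
    then have "card V * D\<^sup>2 \<le> budget" by (simp add: budget_def le_SucI)
    also have "\<dots> \<le> cap" using R L by (simp add: cap_def)
    finally show ?thesis .
  qed
  moreover have "cap \<ge> 1" using R L budget_pos by (simp add: cap_def Suc_le_eq)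
  moreover have "card (insert (Num 0 (length es)) (Edge 0 ` stored es)) \<le> 1 + card (stored es)"
  proof -
    have "finite (stored es)" by (simp add: stored_def)
    then have "card (Edge 0 ` stored es) \<le> card (stored es)" by (rule card_image_le)
    moreover have "card (insert (Num 0 (length es)) (Edge 0 ` stored es)) \<le> Suc (card (Edge 0 ` stored es))"
      by (rule card_insert_le_m1) simp_all
    ultimately show ?thesis by simp
  qed
  moreover have "card (memory es) \<le> card (insert (Num 0 (length es)) (Edge 0 ` stored es)) +
      card (slot_items 1 (slot (level (length es)) es)) + card (slot_items 2 (slot (level (length es) + 1) es))"
    unfolding memory_def by (intro order_trans[OF card_Un_le] add_mono order_refl)
  \<comment> \<open>There are in fact eight terms of size at most \<open>cap\<close>: two for the
    counter and \<open>stored\<close>, three for each slot.\<close>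
  ultimately show "card (memory es) \<le> 10 * cap"
    using slot_items_bounds(2)[OF G _ len, of 1 "level (length es)"]
      slot_items_bounds(2)[OF G _ len, of 2 "level (length es) + 1"] by simp
qed

end

section \<open>Approximation guarantee and choice of the parameters\<close>

lemma (in slot_schedule) answer_short_stream:
  assumes "length es < start 1"
  shows "max_matching (set es) (answer es)"
  using assms some_max_matching[of "set es"] by (simp add: answer_def)

lemma (in slot_schedule) answer_long_stream:
  assumes "start 1 \<le> length es" "slot (level (length es)) es = (H, q, U)"
  shows "max_matching (H \<union> U) (answer es)" "H \<union> U \<subseteq> set es"
proof -
  have "H \<subseteq> set (drop (start (level (length es))) es)" "U \<subseteq> set (drop (start (level (length es))) es)"
    using slot_run_bounds[OF assms(2)[unfolded slot_def]] by auto
  then show *: "H \<union> U \<subseteq> set es" by (auto dest: in_set_dropD)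
  then have "finite (H \<union> U)" by (rule finite_subset) simp
  then show "max_matching (H \<union> U) (answer es)"
    using some_max_matching[of "H \<union> U"] assms by (simp add: answer_def)
qed

text \<open>Half of \<open>\<epsilon>\<close> covers the lost matching edges. In the rest the
  products \<open>w * \<epsilon>\<close> have the helpful sign, so
  \<open>5 * w \<le> \<epsilon>\<close> is enough.\<close>

lemma approximation_arith:
  fixes w \<epsilon> \<mu> a x :: real
  assumes \<epsilon>: "0 < \<epsilon>" "\<epsilon> < 1" and w: "0 < w" "w \<le> \<epsilon> / 12" and a: "a \<le> \<epsilon> / 2 * \<mu>" and "\<mu> \<ge> 0"
    and bound: "(1 - w) * (\<mu> - a) \<le> (3/2 + 6 * w) * x"
  shows "(2 / 3 - \<epsilon>) * \<mu> \<le> x"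
proof -
  have "0 \<le> w * \<epsilon>" using \<epsilon> w by simp
  then have "(3/2 + 6 * w) * (2 / 3 - \<epsilon>) \<le> (1 - w) * (1 - \<epsilon> / 2)"
  proof -
    have lhs: "(3/2 + 6 * w) * (2 / 3 - \<epsilon>) = 1 + 4 * w - 3 / 2 * \<epsilon> - 6 * (w * \<epsilon>)"
      by (simp add: field_simps)
    have rhs: "(1 - w) * (1 - \<epsilon> / 2) = 1 - w - \<epsilon> / 2 + (w * \<epsilon>) / 2"
      by (simp add: field_simps)
    show ?thesis unfolding lhs rhs using \<open>0 \<le> w * \<epsilon>\<close> w \<epsilon> by argo
  qed
  then have "((3/2 + 6 * w) * (2 / 3 - \<epsilon>)) * \<mu> \<le> ((1 - w) * (1 - \<epsilon> / 2)) * \<mu>"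
    using \<open>\<mu> \<ge> 0\<close> by (rule mult_right_mono)
  also have "\<dots> = (1 - w) * (\<mu> - \<epsilon> / 2 * \<mu>)" by (simp add: algebra_simps)
  also have "\<dots> \<le> (1 - w) * (\<mu> - a)" using a w \<epsilon> by (intro mult_left_mono) auto
  finally have "(3/2 + 6 * w) * ((2 / 3 - \<epsilon>) * \<mu>) \<le> (3/2 + 6 * w) * x" using bound by (simp only: mult.assoc)
  then show ?thesis using w by simp
qed

text \<open>A stream shorter than \<open>start 1\<close> is solved exactly. On a longer one each of
  the two failures of the slot has probability at most \<open>n powr (- (c + 1))\<close>, and
  \<open>n \<ge> 2\<close> absorbs the factor 2.\<close>

lemma (in slot_schedule) prob_answer:
  fixes c \<epsilon> :: real
  assumes c: "c > 0" and \<epsilon>: "0 < \<epsilon>" "\<epsilon> < 1" and n: "card V \<ge> 2"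
    and D12: "12 / \<epsilon> \<le> real D" and R48: "48 / \<epsilon> \<le> real R" and Llog: "(c + 4) * log 2 (real (card V)) \<le> real L"
    and G: "simple_graph V E"
  shows "measure_pmf.prob (random_order E)
            {es. matching E (answer es) \<and> real (card (answer es)) \<ge> (2 / 3 - \<epsilon>) * real (matching_number E)}
          \<ge> 1 - real (card V) powr (- c)"
proof -
  let ?P = "measure_pmf.prob (random_order E)" and ?n = "real (card V)" and ?\<mu> = "real (matching_number E)"
    and ?m = "card E"
  define good where "good es \<longleftrightarrow> matching E (answer es) \<and> real (card (answer es)) \<ge> (2 / 3 - \<epsilon>) * ?\<mu>" for es
  have finE: "finite E" using G by (rule simple_graph_finite)
  show ?thesis unfolding good_def[symmetric]
  proof (cases "?m < start 1")
    case True
    have "?P {es. True} \<le> ?P {es. good es}"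
    proof (rule prob_random_order_mono[OF finE])
      fix es assume es: "distinct es" "set es = E"
      then have "length es = ?m" by (metis distinct_card)
      then have "max_matching E (answer es)" using answer_short_stream[of es] True es by simp
      moreover have "(2 / 3 - \<epsilon>) * ?\<mu> \<le> 1 * ?\<mu>" using \<epsilon> by (intro mult_right_mono) auto
      ultimately show "good es" by (simp add: good_def max_matching_def)
    qed
    then have "1 \<le> ?P {es. good es}" by simp
    then show "1 - ?n powr (- c) \<le> ?P {es. good es}" using powr_ge_zero[of ?n "- c"] by linarith
  next
    case False
    define j where "j = level ?m"
    define k where "k = start j + budget * \<alpha> j"
    \<comment> \<open>About a share \<open>\<epsilon> / 4\<close> of the matching may fall into the
      first \<open>k\<close> edges; the matching number is large enough to absorb the rounding into
      \<open>\<epsilon> / 2\<close>.\<close>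
    define a where "a = nat \<lceil>\<epsilon> / 4 * ?\<mu>\<rceil>"
    have low: "start (j + 1) \<le> ?m" using start_level_le[of ?m] False by (simp add: j_def)
    have high: "?m < start (j + 2)" using less_start_level by (simp add: j_def)
    have k2: "k = 2 * start j" by (simp add: k_def start_def)
    have kR: "R * k \<le> 2 * ?m" using low by (simp add: k2 start_Suc)
    have km: "k \<le> ?m"
    proof -
      have "2 * k \<le> R * k" using R by simp
      then show ?thesis using kR by linarith
    qed
    have m_pos: "?m > 0" using low start_strict_mono L R budget_pos by (auto simp: start_def \<alpha>_def intro: gr0I)

    have lg: "1 \<le> log 2 ?n" using n by simp
    have ln_lg: "ln ?n \<le> log 2 ?n"
    proof -
      have "ln 2 \<le> (1::real)" using ln_le_minus_one[of "2::real"] by simp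
      then have "ln ?n * ln 2 \<le> ln ?n * 1" using n by (intro mult_left_mono) auto
      then show ?thesis by (simp add: log_def field_simps)
    qed
    \<comment> \<open>A stream that is not stored has at least \<open>card V * L * R\<close> edges,
      while a vertex cover of \<open>2 * matching_number E\<close> vertices meets at most
      \<open>card V\<close> edges per vertex.\<close>
    have \<mu>_large: "L * R \<le> 2 * matching_number E"
    proof -
      have "card V * (L * R) \<le> card V * D ^ 4 * (L * R)" using D by simp
      also have "\<dots> \<le> start 1" by (simp add: start_def budget_def \<alpha>_def)
      also have "\<dots> \<le> ?m" using False by simp
      also have "\<dots> \<le> card V * (2 * matching_number E)"
        using card_le_matching_number_times_vertices[OF G] by (simp add: mult_ac)
      finally show ?thesis using n by simp
    qed
    have "48 \<le> \<epsilon> * real R" using R48 \<epsilon> by (simp add: field_simps)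
    then have "48 * real L \<le> (\<epsilon> * real R) * real L" by (intro mult_right_mono) auto
    also have "\<dots> = \<epsilon> * real (L * R)" by simp
    also have "\<dots> \<le> \<epsilon> * real (2 * matching_number E)"
      using \<mu>_large \<epsilon> by (intro mult_left_mono) (simp_all only: of_nat_le_iff less_imp_le)
    finally have \<delta>\<mu>: "6 * real L \<le> \<epsilon> / 4 * ?\<mu>" by simp
    have L1: "1 \<le> real L" using L by simp
    have a_low: "\<epsilon> / 4 * ?\<mu> \<le> real a" unfolding a_def by (rule real_nat_ceiling_ge)
    have a_high: "real a \<le> \<epsilon> / 2 * ?\<mu>"
    proof -
      have "real a \<le> \<epsilon> / 4 * ?\<mu> + 1" using \<delta>\<mu> L1 unfolding a_def by linarith
      then show ?thesis using \<delta>\<mu> L1 by simp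
    qed
    have a_pos: "a > 0" using a_low \<delta>\<mu> L1 by linarith
    have a_log: "(c + 1) * log 2 ?n \<le> real a"
    proof -
      have "(c + 1) * log 2 ?n \<le> (c + 4) * log 2 ?n" using lg by (intro mult_right_mono) auto
      then show ?thesis using Llog a_low \<delta>\<mu> L1 by linarith
    qed
    have n_pos: "?n > 0" using n by simp

    \<comment> \<open>The first \<open>k\<close> edges are at most a share
      \<open>2 / R \<le> \<epsilon> / 24\<close> of the stream, and \<open>a\<close> is at least
      \<open>\<epsilon> / 4 * ?\<mu>\<close>: the 48 is chosen to make this base 1/2.\<close>
    have "3 * ?\<mu> * real k / (real a * real ?m) \<le> 1 / 2"
    proof -
      have "real R * real k \<le> 2 * real ?m" using of_nat_mono[OF kR, where 'a = real] by simp
      moreover have "48 / \<epsilon> * real k \<le> real R * real k" using R48 by (intro mult_right_mono) auto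
      ultimately have "48 / \<epsilon> * real k \<le> 2 * real ?m" by linarith
      then have "24 * real k \<le> \<epsilon> * real ?m" using \<epsilon> by (simp add: field_simps)
      then have "?\<mu> * (24 * real k) \<le> ?\<mu> * (\<epsilon> * real ?m)" by (intro mult_left_mono) auto
      also have "\<dots> = 4 * (\<epsilon> / 4 * ?\<mu>) * real ?m" by simp
      also have "\<dots> \<le> 4 * real a * real ?m" using a_low by (intro mult_right_mono) auto
      finally show ?thesis using a_pos m_pos by (simp add: field_simps)
    qed
    then have "(3 * ?\<mu> * real k / (real a * real ?m)) ^ a \<le> (1 / 2) ^ a" by (intro power_mono) auto
    also have "\<dots> = 2 powr (- real a)" by (simp add: powr_minus powr_realpow power_divide field_simps)
    also have "\<dots> \<le> 2 powr (log 2 ?n * (- (c + 1)))" using a_log by (simp add: algebra_simps)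
    also have "\<dots> = ?n powr (- (c + 1))" using n_pos by (simp add: powr_powr[symmetric])
    finally have tail: "(3 * ?\<mu> * real k / (real a * real ?m)) ^ a \<le> ?n powr (- (c + 1))" .

    \<comment> \<open>The union bound runs over at most \<open>n ^ 3\<close> positions, so the
      \<open>c + 4\<close> in the choice of \<open>L\<close> leaves the exponent
      \<open>c + 1\<close>.\<close>
    have "real (?m + 1) * exp (- (real (\<alpha> j) * real cap / real ?m)) \<le> ?n powr 3 * ?n powr (- (c + 4))"
    proof (rule mult_mono)
      have "E \<subseteq> {e. e \<subseteq> V \<and> card e = 2}" using G by (auto simp: simple_graph_def)
      then have "?m \<le> (card V)\<^sup>2"
        using card_mono[OF finite_edges] card_edges_le[OF finV] by (meson order_trans)
      moreover have "2 * (card V)\<^sup>2 \<le> card V * (card V)\<^sup>2" using n by (intro mult_right_mono) auto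
      moreover have "1 \<le> (card V)\<^sup>2" using n by (simp add: Suc_le_eq)
      moreover have "card V ^ 3 = card V * (card V)\<^sup>2" by (simp add: power3_eq_cube power2_eq_square)
      ultimately have "?m + 1 \<le> card V ^ 3" by linarith
      then have "real (?m + 1) \<le> real (card V ^ 3)" by (simp only: of_nat_le_iff)
      also have "\<dots> = ?n powr 3" using n_pos by simp
      finally show "real (?m + 1) \<le> ?n powr 3" .
      have "?m * L \<le> start (j + 2) * L" using high by (intro mult_right_mono) auto
      also have "start (j + 2) * L = \<alpha> j * cap"
        by (simp add: start_def \<alpha>_def cap_def power2_eq_square)
      finally have "real ?m * real L \<le> real (\<alpha> j) * real cap" by (metis of_nat_le_iff of_nat_mult)
      then have "real L \<le> real (\<alpha> j) * real cap / real ?m" using m_pos by (simp add: field_simps)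
      moreover have "(c + 4) * ln ?n \<le> (c + 4) * log 2 ?n" using ln_lg c by (intro mult_left_mono) auto
      ultimately have "(c + 4) * ln ?n \<le> real (\<alpha> j) * real cap / real ?m" using Llog by linarith
      then show "exp (- (real (\<alpha> j) * real cap / real ?m)) \<le> ?n powr (- (c + 4))"
      proof -
        have "?n powr (- (c + 4)) = exp (- ((c + 4) * ln ?n))"
          unfolding powr_def using n_pos by (simp add: left_diff_distrib distrib_right)
        then show ?thesis using \<open>(c + 4) * ln ?n \<le> real (\<alpha> j) * real cap / real ?m\<close> by simp
      qed
    qed auto
    also have "\<dots> = ?n powr (3 + - (c + 4))" by (simp only: powr_add)
    also have "3 + - (c + 4) = - (c + 1)" by simp
    finally have bad: "real (?m + 1) * exp (- (real (\<alpha> j) * real cap / real ?m)) \<le> ?n powr (- (c + 1))" .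

    have D12': "D \<ge> 12"
    proof -
      have "12 \<le> 12 / \<epsilon>" using \<epsilon> by (simp add: field_simps)
      then show ?thesis using D12 by linarith
    qed
    define ok where "ok es \<longleftrightarrow> (case slot_run V D (\<alpha> j) cap (drop (start j) es) of (H, q, U) \<Rightarrow>
      (1 - 1 / real D) * (?\<mu> - real a) \<le> (3/2 + 6 / real D) * real (matching_number (H \<union> U)))" for es
    have "?P {es. \<not> good es} \<le> ?P {es. \<not> ok es}"
    proof (rule prob_random_order_mono[OF finE], rule ccontr)
      fix es assume es: "distinct es" "set es = E" and "\<not> good es" "\<not> \<not> ok es"
      then have "ok es" by simp
      have len: "length es = ?m" using es by (metis distinct_card)
      obtain H q U where run: "slot j es = (H, q, U)" by (metis prod_cases3)
      have max: "max_matching (H \<union> U) (answer es)" "H \<union> U \<subseteq> E"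
        using answer_long_stream[of es H q U] False len run es(2) by (simp_all add: j_def)
      have "(1 - 1 / real D) * (?\<mu> - real a) \<le> (3/2 + 6 * (1 / real D)) * real (matching_number (H \<union> U))"
        using \<open>ok es\<close> run by (simp add: ok_def slot_def)
      moreover have "1 / real D \<le> \<epsilon> / 12" using D12 D12' \<epsilon> by (simp add: field_simps)
      ultimately have "(2 / 3 - \<epsilon>) * ?\<mu> \<le> real (matching_number (H \<union> U))"
        using D12' a_high \<epsilon> by (intro approximation_arith[of \<epsilon> "1 / real D" "real a" ?\<mu>]) auto
      then have "good es" using max matching_mono unfolding good_def max_matching_def matching_def by auto
      with \<open>\<not> good es\<close> show False by simp
    qed
    also have "\<dots> \<le> ?n powr (- (c + 1)) + ?n powr (- (c + 1))"
      unfolding ok_def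
      using prob_slot_matching[OF G D12' a_pos, of "start j" "\<alpha> j" k cap] km bad tail
      by (simp add: k_def budget_def)
    also have "\<dots> \<le> ?n powr (- c)"
    proof -
      have "2 * ?n powr (- (c + 1)) \<le> ?n * ?n powr (- (c + 1))" using n by (intro mult_right_mono) auto
      also have "\<dots> = ?n powr (- c)" using n_pos by (simp add: powr_mult_base)
      finally show ?thesis by simp
    qed
    finally have "?P {es. \<not> good es} \<le> ?n powr (- c)" .
    moreover have "?P {es. \<not> good es} = 1 - ?P {es. good es}"
    proof -
      have "{es. \<not> good es} = UNIV - {es. good es}" by auto
      then show ?thesis using measure_pmf.prob_compl[of "{es. good es}" "random_order E"] by simp
    qed
    ultimately show "1 - ?n powr (- c) \<le> ?P {es. good es}" by linarith
  qed
qed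

text \<open>Four of the six powers of \<open>1 / \<epsilon>\<close> come from the potential bound
  \<open>D ^ 4\<close>, two from \<open>R\<^sup>2\<close>. The constants 13, 49 and
  \<open>c + 5\<close> absorb the rounding of 12, 48 and \<open>c + 4\<close>.\<close>

lemma (in slot_schedule) cap_le:
  fixes c \<epsilon> :: real
  assumes c: "c > 0" and \<epsilon>: "0 < \<epsilon>" and n: "card V \<ge> 2"
    and "real D \<le> 13 / \<epsilon>" "real R \<le> 49 / \<epsilon>" "real L \<le> (c + 5) * log 2 (real (card V))"
  shows "real cap \<le> 2 * 13 ^ 4 * 49\<^sup>2 * (c + 5) * (real (card V) * log 2 (real (card V)) * (1 / \<epsilon>) ^ 6)"
proof -
  have "1 \<le> card V * D ^ 4" using n D by (simp add: Suc_le_eq)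
  then have "budget \<le> 2 * (card V * D ^ 4)" by (simp add: budget_def)
  then have "real budget \<le> real (2 * (card V * D ^ 4))" by (simp only: of_nat_le_iff)
  also have "\<dots> = 2 * real (card V) * real D ^ 4" by simp
  also have "\<dots> \<le> 2 * real (card V) * (13 / \<epsilon>) ^ 4" using assms by (intro mult_left_mono power_mono) auto
  finally have b: "real budget \<le> 2 * real (card V) * (13 / \<epsilon>) ^ 4" .
  have "real cap = real budget * real R ^ 2 * real L" by (simp add: cap_def)
  also have "\<dots> \<le> (2 * real (card V) * (13 / \<epsilon>) ^ 4) * (49 / \<epsilon>)\<^sup>2 * ((c + 5) * log 2 (real (card V)))"
    using assms b by (intro mult_mono power_mono) auto
  also have "\<dots> = 2 * 13 ^ 4 * 49\<^sup>2 * (c + 5) * (real (card V) * log 2 (real (card V)) * (1 / \<epsilon>) ^ 6)"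
    using \<epsilon> by (simp add: field_simps power_divide)
  finally show ?thesis .
qed

theorem theorem1:
  fixes c :: real
  assumes "c > 0"
  shows "\<exists>(C::real) (k::nat). \<forall>(V::'a set) (\<epsilon>::real).
    finite V \<longrightarrow> 0 < \<epsilon> \<longrightarrow> \<epsilon> < 1 \<longrightarrow>
    (\<exists>(A :: ('a set, 'a set set) streaming_alg) (w::nat).
       real w \<le> C * log 2 (real (card V)) \<and>
       uses_space V A w (C * (real (card V) * log 2 (real (card V)) * (1 / \<epsilon>) ^ k)) \<and>
       (\<forall>E. simple_graph V E \<longrightarrow>
          measure_pmf.prob (random_order E)
            {es. matching E (output_on A es) \<and>
                 real (card (output_on A es)) \<ge> (2 / 3 - \<epsilon>) * real (matching_number E)}
          \<ge> 1 - real (card V) powr (- c)))"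
proof (intro exI[of _ "10 * (2 * 13 ^ 4 * 49\<^sup>2 * (c + 5))"] exI[of _ 6] allI impI)
  fix V :: "'a set" and \<epsilon> :: real
  assume finV: "finite V" and \<epsilon>: "0 < \<epsilon>" "\<epsilon> < 1"
  \<comment> \<open>The factor 10 is that of \<open>memory_bounds\<close>, the rest comes from
    \<open>cap_le\<close>.\<close>
  let ?C = "10 * (2 * 13 ^ 4 * 49\<^sup>2 * (c + 5))" and ?n = "real (card V)"
  have C7: "?C \<ge> 7" using assms by simp
  show "\<exists>(A :: ('a set, 'a set set) streaming_alg) (w::nat).
       real w \<le> ?C * log 2 ?n \<and>
       uses_space V A w (?C * (?n * log 2 ?n * (1 / \<epsilon>) ^ 6)) \<and>
       (\<forall>E. simple_graph V E \<longrightarrow>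
          measure_pmf.prob (random_order E)
            {es. matching E (output_on A es) \<and>
                 real (card (output_on A es)) \<ge> (2 / 3 - \<epsilon>) * real (matching_number E)}
          \<ge> 1 - ?n powr (- c))"
  proof (cases "card V \<ge> 2")
    \<comment> \<open>With fewer than two vertices \<open>log 2 n\<close> is 0, also for
      \<open>n = 0\<close> by the convention \<open>ln 0 = 0\<close>, so the memory must stay empty.
      There are no edges then.\<close>
    case False
    define A :: "('a set, 'a set set) streaming_alg"
      where "A = \<lparr>init_mem = [], update_mem = (\<lambda>_ _. []), result = (\<lambda>_. {})\<rparr>"
    have "memory_after A es = []" for es by (induction es rule: rev_induct) (auto simp: memory_after_def A_def)
    then have mem: "memory_after A es = []" and out: "output_on A es = {}" for es
      by (auto simp: output_on_def A_def)
    have log0: "log 2 ?n = 0" using False by (cases "card V") (auto simp: log_def)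
    have empty: "E = {}" if G: "simple_graph V E" for E
    proof (rule ccontr)
      assume "E \<noteq> {}"
      then obtain e where "e \<subseteq> V" "card e = 2" using G by (auto simp: simple_graph_def)
      then show False using False card_mono[OF finV, of e] by simp
    qed
    have \<mu>0: "matching_number ({} :: 'a set set) = 0"
      by (rule maximum_matching_exists[of "{} :: 'a set set"]) (auto simp: matching_def)
    have "1 - ?n powr (- c) \<le> measure_pmf.prob (random_order E)
        {es. matching E (output_on A es) \<and> real (card (output_on A es)) \<ge> (2 / 3 - \<epsilon>) * real (matching_number E)}"
      if "simple_graph V E" for E
      using empty[OF that] by (simp add: out matching_empty \<mu>0)
    moreover have "uses_space V A 0 (?C * (?n * log 2 ?n * (1 / \<epsilon>) ^ 6))"
      by (simp add: uses_space_def mem log0)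
    ultimately show ?thesis using log0 by (intro exI[of _ A] exI[of _ 0]) simp
  next
    case n: True
    define D R L where "D = nat \<lceil>12 / \<epsilon>\<rceil>" and "R = nat \<lceil>48 / \<epsilon>\<rceil>" and "L = nat \<lceil>(c + 4) * log 2 ?n\<rceil>"
    have lg: "1 \<le> log 2 ?n" using n by simp
    have inv: "1 \<le> 1 / \<epsilon>" using \<epsilon> by (simp add: field_simps)
    have cl: "1 \<le> (c + 4) * log 2 ?n" using lg assms mult_mono[of 1 "c + 4" 1 "log 2 ?n"] by simp
    have D_le: "12 / \<epsilon> \<le> real D" "real D \<le> 13 / \<epsilon>"
      unfolding D_def using inv by linarith+
    have R_le: "48 / \<epsilon> \<le> real R" "real R \<le> 49 / \<epsilon>"
      unfolding R_def using inv by linarith+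
    have L_le: "(c + 4) * log 2 ?n \<le> real L" "real L \<le> (c + 5) * log 2 ?n"
    proof -
      show "(c + 4) * log 2 ?n \<le> real L" unfolding L_def by linarith
      have "real L \<le> (c + 4) * log 2 ?n + 1" unfolding L_def using cl by linarith
      then show "real L \<le> (c + 5) * log 2 ?n" using lg by (simp add: algebra_simps)
    qed
    interpret slot_schedule V D R L
    proof
      show "finite V" by fact
      show "R \<ge> 2" "D \<ge> 1" "L \<ge> 1" using R_le D_le L_le inv cl by linarith+
    qed
    \<comment> \<open>By \<open>card_universe_le\<close> there are at most
      \<open>9 * n\<^sup>2 + 3\<close> items, which is below \<open>n ^ 6\<close> for
      \<open>n \<ge> 2\<close>.\<close>
    define w where "w = nat \<lceil>6 * log 2 ?n\<rceil>"
    have w: "real w \<le> 7 * log 2 ?n" unfolding w_def using lg by linarith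
    have "card universe \<le> 2 ^ w"
    proof -
      have "4 \<le> (card V)\<^sup>2" using power_mono[OF n, of 2] by simp
      moreover have "16 \<le> card V ^ 4" using power_mono[OF n, of 4] by simp
      then have "16 * (card V)\<^sup>2 \<le> card V ^ 4 * (card V)\<^sup>2" by (intro mult_right_mono) auto
      ultimately have "card universe \<le> card V ^ 4 * (card V)\<^sup>2" using card_universe_le by linarith
      also have "\<dots> = card V ^ 6" by (simp flip: power_add)
      finally have "real (card universe) \<le> real (card V ^ 6)" by (simp only: of_nat_le_iff)
      also have "\<dots> = ?n powr 6" using n by simp
      also have "\<dots> = 2 powr (log 2 ?n * 6)" using n by (simp add: powr_powr[symmetric])
      also have "\<dots> \<le> 2 powr (real w)" unfolding w_def using real_nat_ceiling_ge[of "6 * log 2 ?n"]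
        by (intro powr_mono) (simp_all add: mult.commute)
      also have "\<dots> = real (2 ^ w)" by (simp add: powr_realpow)
      finally show ?thesis by (simp only: of_nat_le_iff)
    qed
    moreover have "memory es \<subseteq> universe \<and> real (card (memory es)) \<le> ?C * (?n * log 2 ?n * (1 / \<epsilon>) ^ 6)"
      if "distinct es" "simple_graph V (set es)" for es
    proof -
      have "real (card (memory es)) \<le> 10 * real cap"
        using of_nat_mono[OF memory_bounds(2)[OF that], where 'a = real] by simp
      also have "\<dots> \<le> 10 * (2 * 13 ^ 4 * 49\<^sup>2 * (c + 5) * (?n * log 2 ?n * (1 / \<epsilon>) ^ 6))"
        using cap_le[OF assms \<epsilon>(1) n D_le(2) R_le(2) L_le(2)] by simp
      finally show ?thesis using memory_bounds(1)[OF that] by (simp only: mult.assoc)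
    qed
    ultimately obtain A where A: "uses_space V A w (?C * (?n * log 2 ?n * (1 / \<epsilon>) ^ 6))"
      "\<And>es. distinct es \<Longrightarrow> simple_graph V (set es) \<Longrightarrow> output_on A es = answer es"
      using streaming_alg_exists[of memory answer universe w V, OF memory_snoc_cong answer_cong finite_universe]
      by metis
    show ?thesis
    proof (intro exI[of _ A] exI[of _ w] conjI allI impI)
      show "real w \<le> ?C * log 2 ?n" using w mult_right_mono[OF C7, of "log 2 ?n"] lg by linarith
      show "uses_space V A w (?C * (?n * log 2 ?n * (1 / \<epsilon>) ^ 6))" by (rule A)
      fix E assume G: "simple_graph V E"
      have "1 - ?n powr (- c) \<le> measure_pmf.prob (random_order E)
            {es. matching E (answer es) \<and> real (card (answer es)) \<ge> (2 / 3 - \<epsilon>) * real (matching_number E)}"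
        using assms \<epsilon> n D_le(1) R_le(1) L_le(1) G by (rule prob_answer)
      also have "\<dots> \<le> measure_pmf.prob (random_order E)
            {es. matching E (output_on A es) \<and> real (card (output_on A es)) \<ge> (2 / 3 - \<epsilon>) * real (matching_number E)}"
        using A(2) G by (intro prob_random_order_mono simple_graph_finite[OF G]) auto
      finally show "measure_pmf.prob (random_order E)
            {es. matching E (output_on A es) \<and> real (card (output_on A es)) \<ge> (2 / 3 - \<epsilon>) * real (matching_number E)}
          \<ge> 1 - ?n powr (- c)" .
    qed
  qed
qed

end
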